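(* Let $I$ be a finite set and let $(\langle X_i,\tau_i,\mathsf{FO}[\sigma_i]\rangle)_{i\in I}$ be a family of logically presented pre-spectral spaces, where each $\sigma_i$ is a finite relational signature and $X_i$ is a set of $\sigma_i$-structures. Then the logical product of this family is a logically presented pre-spectral space, and it is homeomorphic to the product of the spaces $\langle X_i,\tau_i,\mathsf{FO}[\sigma_i]\rangle$ in the category $\mathbf{PreSpec}$.
   Context: "Compact" means every open cover has a finite subcover (no separation axiom). For a set $X$, a topology $\tau$ on $X$ and a sublattice $\mathcal{L}$ of $\wp(X)$ containing $\emptyset$ and $X$, $\langle X,\tau,\mathcal{L}\rangle$ denotes the space $X$ with the topology $\langle\tau\cap\mathcal{L}\rangle$ generated by $\tau\cap\mathcal{L}$; it is a logically presented pre-spectral space if every element of $\tau\cap\mathcal{L}$ is compact in this topology. When $X$ is a set of $\sigma$-structures, $\langle X,\tau,\mathsf{FO}[\sigma]\rangle$ stands for $\langle X,\tau,\mathcal{L}\rangle$ with $\mathcal{L}$ the collection of sets $[\![\varphi]\!]_X=\{A\in X\mid A\models\varphi\}$ for first-order $\sigma$-sentences $\varphi$. Logical product: given $(\langle X_i,\tau_i,\mathsf{FO}[\sigma_i]\rangle)_{i\in I}$, its logical product is $\langle X,\tau,\mathsf{FO}[\sigma]\rangle$ where: (1) $\sigma$ is the disjoint union of the signatures $\sigma_i$ together with a new unary predicate $\varepsilon_i$ for each $i\in I$; (2) $X$ is the image of $\prod_{i\in I}X_i$ under the map $f$ sending $(A_i)_{i\in I}$ to the $\sigma$-structure that is the disjoint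 union of the $A_i$ (each relation of $\sigma_i$ being interpreted as in $A_i$ on the copy of $A_i$ and containing no other tuples), with $\varepsilon_i$ true exactly on the elements of $A_i$ (so $f$ is a bijection from $\prod_i X_i$ onto $X$); (3) $\tau$ is the topology on $X$ generated by the sets $U$ such that $f^{-1}(U)$ is open in the topological product $\prod_{i\in I}(X_i,\tau_i)$. A topological space is pre-spectral if its compact open subsets form a sublattice of its powerset containing $\emptyset$ and the whole space and generate the topology. A spectral map is a continuous map such that preimages of compact open sets are compact open. $\mathbf{PreSpec}$ is the category of pre-spectral spaces and spectral maps. Every logically presented pre-spectral space $\langle X,\tau,\mathcal{L}\rangle$ is regarded as the pre-spectral space $(X,\langle\tau\cap\mathcal{L}\rangle)$. *)

theory Defs
  imports "HOL-Analysis.Function_Topology"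
begin

section \<open>First-order logic over relational signatures\<close>

text \<open>A relational signature maps each of its relation symbols to its arity; \<open>dom \<sigma>\<close> is the set
  of symbols.\<close>

type_synonym 'r signature = "'r \<rightharpoonup> nat"

datatype ('r, 'a) struct = Struct (univ: "'a set") (interp: "'r \<Rightarrow> 'a list set")

text \<open>Symbols outside the signature are interpreted by the empty set, so that HOL equality of
  structures is equality of \<open>\<sigma>\<close>-structures. The universe may be empty; this is needed because the
  disjoint union of the empty family is the empty structure.\<close>

definition is_structure :: "'r signature \<Rightarrow> ('r, 'a) struct \<Rightarrow> bool" where
  "is_structure \<sigma> A \<longleftrightarrow>
     (\<forall>r. case \<sigma> r of
            Some n \<Rightarrow> interp A r \<subseteq> {t. length t = n \<and> set t \<subseteq> univ A}
          | None \<Rightarrow> interp A r = {})"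

text \<open>The remaining connectives and the universal quantifier are definable.\<close>

datatype 'r fm =
    FEq nat nat
  | FRel 'r "nat list"
  | FNeg "'r fm"
  | FConj "'r fm" "'r fm"
  | FEx nat "'r fm"

primrec free_vars :: "'r fm \<Rightarrow> nat set" where
  "free_vars (FEq x y) = {x, y}"
| "free_vars (FRel r xs) = set xs"
| "free_vars (FNeg \<phi>) = free_vars \<phi>"
| "free_vars (FConj \<phi> \<psi>) = free_vars \<phi> \<union> free_vars \<psi>"
| "free_vars (FEx x \<phi>) = free_vars \<phi> - {x}"

primrec is_formula :: "'r signature \<Rightarrow> 'r fm \<Rightarrow> bool" where
  "is_formula \<sigma> (FEq x y) \<longleftrightarrow> True"
| "is_formula \<sigma> (FRel r xs) \<longleftrightarrow> \<sigma> r = Some (length xs)"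
| "is_formula \<sigma> (FNeg \<phi>) \<longleftrightarrow> is_formula \<sigma> \<phi>"
| "is_formula \<sigma> (FConj \<phi> \<psi>) \<longleftrightarrow> is_formula \<sigma> \<phi> \<and> is_formula \<sigma> \<psi>"
| "is_formula \<sigma> (FEx x \<phi>) \<longleftrightarrow> is_formula \<sigma> \<phi>"

definition is_sentence :: "'r signature \<Rightarrow> 'r fm \<Rightarrow> bool" where
  "is_sentence \<sigma> \<phi> \<longleftrightarrow> is_formula \<sigma> \<phi> \<and> free_vars \<phi> = {}"

primrec sat :: "('r, 'a) struct \<Rightarrow> (nat \<Rightarrow> 'a) \<Rightarrow> 'r fm \<Rightarrow> bool" where
  "sat A \<nu> (FEq x y) \<longleftrightarrow> \<nu> x = \<nu> y"
| "sat A \<nu> (FRel r xs) \<longleftrightarrow> map \<nu> xs \<in> interp A r"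
| "sat A \<nu> (FNeg \<phi>) \<longleftrightarrow> \<not> sat A \<nu> \<phi>"
| "sat A \<nu> (FConj \<phi> \<psi>) \<longleftrightarrow> sat A \<nu> \<phi> \<and> sat A \<nu> \<psi>"
| "sat A \<nu> (FEx x \<phi>) \<longleftrightarrow> (\<exists>a\<in>univ A. sat A (\<nu>(x := a)) \<phi>)"

text \<open>Only used for sentences, whose satisfaction does not depend on \<open>\<nu>\<close>. The assignment ranges over
  the whole type rather than over \<open>univ A\<close>: otherwise every sentence, true or false, would
  hold vacuously in the empty structure.\<close>

definition models :: "('r, 'a) struct \<Rightarrow> 'r fm \<Rightarrow> bool" where
  "models A \<phi> \<longleftrightarrow> (\<forall>\<nu>. sat A \<nu> \<phi>)"

definition FO_sets :: "'r signature \<Rightarrow> ('r, 'a) struct set \<Rightarrow> ('r, 'a) struct set set" where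
  "FO_sets \<sigma> X = {{A \<in> X. models A \<phi>} | \<phi>. is_sentence \<sigma> \<phi>}"

section \<open>Logically presented pre-spectral spaces\<close>

definition bounded_sublattice :: "'x set \<Rightarrow> 'x set set \<Rightarrow> bool" where
  "bounded_sublattice X L \<longleftrightarrow>
     L \<subseteq> Pow X \<and> {} \<in> L \<and> X \<in> L \<and> (\<forall>U\<in>L. \<forall>V\<in>L. U \<union> V \<in> L \<and> U \<inter> V \<in> L)"

definition presented_topology :: "'x topology \<Rightarrow> 'x set set \<Rightarrow> 'x topology" where
  "presented_topology \<tau> L = topology_generated_by ({U. openin \<tau> U} \<inter> L)"

definition logically_presented_prespectral ::
    "'x set \<Rightarrow> 'x topology \<Rightarrow> 'x set set \<Rightarrow> bool" where
  "logically_presented_prespectral X \<tau> L \<longleftrightarrow>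
     topspace \<tau> = X \<and> bounded_sublattice X L \<and>
     (\<forall>U \<in> {U. openin \<tau> U} \<inter> L. compactin (presented_topology \<tau> L) U)"

section \<open>The logical product\<close>

text \<open>\<open>Copy i r\<close> is the symbol \<open>r\<close> of the \<open>i\<close>-th signature in the disjoint union of signatures, and
  \<open>Mark i\<close> is the new unary predicate \<open>\<epsilon>\<^sub>i\<close>.\<close>

datatype ('i, 'r) sum_symbol = Copy 'i 'r | Mark 'i

definition sum_signature ::
    "'i set \<Rightarrow> ('i \<Rightarrow> 'r signature) \<Rightarrow> ('i, 'r) sum_symbol signature" where
  "sum_signature I \<sigma> s =
     (case s of
        Copy i r \<Rightarrow> (if i \<in> I then \<sigma> i r else None)
      | Mark i \<Rightarrow> (if i \<in> I then Some 1 else None))"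

definition disjoint_union_structure ::
    "'i set \<Rightarrow> ('i \<Rightarrow> ('r, 'a) struct) \<Rightarrow> (('i, 'r) sum_symbol, 'i \<times> 'a) struct" where
  "disjoint_union_structure I A =
     Struct (SIGMA i:I. univ (A i))
       (\<lambda>s. case s of
              Copy i r \<Rightarrow> (if i \<in> I then map (Pair i) ` interp (A i) r else {})
            | Mark i \<Rightarrow> (if i \<in> I then {[(i, a)] | a. a \<in> univ (A i)} else {}))"

definition logical_product_carrier ::
    "'i set \<Rightarrow> ('i \<Rightarrow> ('r, 'a) struct set) \<Rightarrow> (('i, 'r) sum_symbol, 'i \<times> 'a) struct set" where
  "logical_product_carrier I X = disjoint_union_structure I ` (\<Pi>\<^sub>E i\<in>I. X i)"

definition logical_product_topology ::
    "'i set \<Rightarrow> ('i \<Rightarrow> ('r, 'a) struct set) \<Rightarrow> ('i \<Rightarrow> ('r, 'a) struct topology)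
      \<Rightarrow> (('i, 'r) sum_symbol, 'i \<times> 'a) struct topology" where
  "logical_product_topology I X \<tau> =
     topology_generated_by
       {U. U \<subseteq> logical_product_carrier I X \<and>
           openin (product_topology \<tau> I)
             {A \<in> (\<Pi>\<^sub>E i\<in>I. X i). disjoint_union_structure I A \<in> U}}"

section \<open>The category of pre-spectral spaces\<close>

definition compact_opens :: "'x topology \<Rightarrow> 'x set set" where
  "compact_opens T = {U. openin T U \<and> compactin T U}"

definition prespectral :: "'x topology \<Rightarrow> bool" where
  "prespectral T \<longleftrightarrow>
     bounded_sublattice (topspace T) (compact_opens T) \<and>
     topology_generated_by (compact_opens T) = T"

definition spectral_map :: "'x topology \<Rightarrow> 'y topology \<Rightarrow> ('x \<Rightarrow> 'y) \<Rightarrow> bool" where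
  "spectral_map S T f \<longleftrightarrow>
     continuous_map S T f \<and>
     (\<forall>U\<in>compact_opens T. {x \<in> topspace S. f x \<in> U} \<in> compact_opens S)"

text \<open>\<open>(P, \<pi>)\<close> is a categorical product of \<open>(S i)\<^sub>i\<^sub>\<in>\<^sub>I\<close> in the category of pre-spectral spaces and
  spectral maps. As HOL has no quantification over types inside a formula, the points of
  the test spaces \<open>Z\<close> are taken from the type \<open>'z\<close>; the full universal property is obtained by
  leaving \<open>'z\<close> a type variable. A morphism out of \<open>Z\<close> is determined by its values on
  \<open>topspace Z\<close>, hence the restriction to extensional functions in the uniqueness clause.\<close>

definition PreSpec_product ::
    "'z itself \<Rightarrow> 'i set \<Rightarrow> ('i \<Rightarrow> 'x topology) \<Rightarrow> 'p topology \<Rightarrow> ('i \<Rightarrow> 'p \<Rightarrow> 'x) \<Rightarrow> bool" where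
  "PreSpec_product (_ :: 'z itself) I S P \<pi> \<longleftrightarrow>
     (\<forall>i\<in>I. prespectral (S i)) \<and>
     prespectral P \<and> (\<forall>i\<in>I. spectral_map P (S i) (\<pi> i)) \<and>
     (\<forall>(Z :: 'z topology) g.
        prespectral Z \<and> (\<forall>i\<in>I. spectral_map Z (S i) (g i)) \<longrightarrow>
        (\<exists>!h. h \<in> extensional (topspace Z) \<and> spectral_map Z P h \<and>
              (\<forall>i\<in>I. \<forall>z\<in>topspace Z. \<pi> i (h z) = g i z)))"

end

theory Submission
  imports Defs
begin

text \<open>By a Feferman--Vaught argument, a sentence true in a disjoint union of structures pulls back
  to a finite union of rectangles with first-order definable sides, and relativization to the
  predicates \<open>\<epsilon>\<^sub>i\<close> shows that every such union arises. The rectangles of an open definable set need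
  not be open, but one-dimensional sections of the set are; enlarging the sides to intersections of
  sections exhibits the set as a finite union of rectangles with open definable sides. These unions
  are exactly the compact open sets of the finite product of the given spaces, which is compact by
  Tychonoff, so the bijection between the two carriers matches the generating lattices.\<close>

section \<open>Topologies generated by lattices of compact sets\<close>

text \<open>The obstacle is that openness and definability are witnessed by different rectangles. An
  open set of the logical product is open for the product of the \<open>\<tau> i\<close>, hence a
  union of open boxes whose sides need not be definable; the Feferman-Vaught rectangles have
  definable sides with no control over openness. Sections have both properties: a section of a
  finite union of rectangles is a union of some of their sides, hence definable, and it is the
  preimage of the set under the continuous insertion of one coordinate, hence open. Finiteness of
  \<open>I\<close> lets the negation of a conjunction over all components, and a quantifier over the
  disjoint union, become finite disjunctions over the components; it also makes rectangles with open
  sides open.\<close>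

lemma bounded_sublattice_Union:
  assumes "bounded_sublattice X L" "finite F" "F \<subseteq> L"
  shows "\<Union>F \<in> L"
  using assms(2,3,1) by (induction rule: finite_induct) (auto simp: bounded_sublattice_def)

lemma bounded_sublattice_Inter:
  assumes "bounded_sublattice X L" "finite F" "F \<noteq> {}" "F \<subseteq> L"
  shows "\<Inter>F \<in> L"
  using assms(2,3,4,1) by (induction rule: finite_ne_induct) (auto simp: bounded_sublattice_def)

lemma bounded_sublattice_open_sets:
  assumes "bounded_sublattice (topspace T) L"
  shows "bounded_sublattice (topspace T) ({U. openin T U} \<inter> L)"
  using assms by (auto simp: bounded_sublattice_def)

text \<open>Closure under binary intersections makes \<open>L\<close> a base rather than just a
  subbase, so unions of members already exhaust the topology.\<close>

lemma openin_generated_by_lattice_iff: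
  assumes "bounded_sublattice X L"
  shows "openin (topology_generated_by L) U \<longleftrightarrow> (\<exists>F\<subseteq>L. U = \<Union>F)"
proof
  assume "openin (topology_generated_by L) U"
  then have "generate_topology_on L U"
    by (rule openin_topology_generated_by)
  then show "\<exists>F\<subseteq>L. U = \<Union>F"
  proof induction
    case Empty
    then show ?case by blast
  next
    case (Int a b)
    then obtain F G where FG: "F \<subseteq> L" "a = \<Union>F" "G \<subseteq> L" "b = \<Union>G"
      by blast
    have "a \<inter> b = \<Union>{P \<inter> Q | P Q. P \<in> F \<and> Q \<in> G}"
      using FG by blast
    moreover have "{P \<inter> Q | P Q. P \<in> F \<and> Q \<in> G} \<subseteq> L"
      using FG assms unfolding bounded_sublattice_def by blast
    ultimately show ?case by blast
  next
    case (UN K)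
    \<comment> \<open>The witness will be the family of all members of \<open>L\<close> below the
      union, which avoids choosing a subfamily for every member of \<open>K\<close>.\<close>
    have "\<exists>V\<in>L. x \<in> V \<and> V \<subseteq> \<Union>K" if x: "x \<in> \<Union>K" for x
    proof -
      obtain k where k: "k \<in> K" "x \<in> k"
        using x by blast
      then obtain F where "F \<subseteq> L" "k = \<Union>F"
        using UN.IH by blast
      then show ?thesis
        using k by blast
    qed
    then show ?case
      by (intro exI[of _ "{V \<in> L. V \<subseteq> \<Union>K}"]) blast
  next
    case (Basis s)
    then show ?case by (intro exI[of _ "{s}"]) auto
  qed
next
  assume "\<exists>F\<subseteq>L. U = \<Union>F"
  then obtain F where F: "F \<subseteq> L" "U = \<Union>F"
    by auto
  have "openin (topology_generated_by L) V" if "V \<in> F" for V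
    using that F(1) by (intro topology_generated_by_Basis) blast
  then show "openin (topology_generated_by L) U"
    unfolding F(2) by (rule openin_Union)
qed

text \<open>A compact open set is a union of members of \<open>L\<close>; compactness leaves
  finitely many of them, and their union is again in \<open>L\<close>.\<close>

lemma compact_opens_generated_by_lattice:
  assumes L: "bounded_sublattice X L"
    and cpt: "\<And>U. U \<in> L \<Longrightarrow> compactin (topology_generated_by L) U"
  shows "compact_opens (topology_generated_by L) = L"
proof (intro equalityI subsetI)
  fix U assume "U \<in> compact_opens (topology_generated_by L)"
  then have U: "openin (topology_generated_by L) U" "compactin (topology_generated_by L) U"
    by (auto simp: compact_opens_def)
  obtain F where F: "F \<subseteq> L" "U = \<Union>F"
    using U(1) unfolding openin_generated_by_lattice_iff[OF L] by auto
  have "\<exists>G. finite G \<and> G \<subseteq> F \<and> U \<subseteq> \<Union>G"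
  proof (rule compactinD[OF U(2)])
    fix V assume "V \<in> F"
    then show "openin (topology_generated_by L) V"
      using F(1) by (intro topology_generated_by_Basis) blast
  qed (use F(2) in simp)
  then obtain G where "finite G" "G \<subseteq> F" "U \<subseteq> \<Union>G"
    by auto
  then have "U = \<Union>G"
    using F by blast
  moreover have "\<Union>G \<in> L"
    using \<open>G \<subseteq> F\<close> F(1) by (intro bounded_sublattice_Union[OF L \<open>finite G\<close>]) blast
  ultimately show "U \<in> L"
    by simp
next
  fix U assume "U \<in> L"
  then show "U \<in> compact_opens (topology_generated_by L)"
    by (simp add: compact_opens_def cpt topology_generated_by_Basis)
qed

lemma prespectral_generated_by_lattice:
  assumes L: "bounded_sublattice X L"
    and cpt: "\<And>U. U \<in> L \<Longrightarrow> compactin (topology_generated_by L) U"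
  shows "prespectral (topology_generated_by L)"
proof -
  have "\<Union>L = X"
    using L by (auto simp: bounded_sublattice_def)
  then show ?thesis
    using L compact_opens_generated_by_lattice[OF assms] by (simp add: prespectral_def)
qed

text \<open>Injectivity makes the preimage of \<open>f\<close> V\<open>equal to\<close>V\<open>, so
  the generating sets correspond in both directions. The condition\<close>E \<in>
  R\<open>forces the underlying sets to be\<close>E\<open>and\<close>f \<open>E\<close>.\<close>

lemma homeomorphic_map_generated_image:
  assumes inj: "inj_on f E" and R: "R \<subseteq> Pow E" and E: "E \<in> R"
  shows "homeomorphic_map (topology_generated_by R) (topology_generated_by ((`) f ` R)) f"
proof -
  have ts: "\<Union>R = E" "\<Union>((`) f ` R) = f ` E"
    using R E by auto
  have "continuous_map (topology_generated_by R) (topology_generated_by ((`) f ` R)) f"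
  proof (rule continuous_on_generated_topo)
    fix U assume "U \<in> (`) f ` R"
    then obtain V where V: "V \<in> R" "U = f ` V" by blast
    then have "f -` U \<inter> E = V"
      using inj R by (auto simp: inj_on_def)
    then show "openin (topology_generated_by R) (f -` U \<inter> topspace (topology_generated_by R))"
      using V by (simp add: ts topology_generated_by_Basis)
  qed (use ts in auto)
  moreover have "continuous_map (topology_generated_by ((`) f ` R)) (topology_generated_by R)
      (inv_into E f)"
  proof (rule continuous_on_generated_topo)
    fix V assume V: "V \<in> R"
    then have "inv_into E f -` V \<inter> f ` E = f ` V"
      using inj R by (force simp: inv_into_f_f)
    then show "openin (topology_generated_by ((`) f ` R))
        (inv_into E f -` V \<inter> topspace (topology_generated_by ((`) f ` R)))"
      using V by (simp add: ts topology_generated_by_Basis )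
  qed (use ts inj in auto)
  ultimately have "homeomorphic_maps (topology_generated_by R)
      (topology_generated_by ((`) f ` R)) f (inv_into E f)"
    using inj ts by (auto simp: homeomorphic_maps_def)
  then show ?thesis
    by (simp add: homeomorphic_maps_map)
qed

section \<open>Finite unions of rectangles\<close>

text \<open>The families of sides are extensional as well, which lets \<open>finite_PiE\<close>
  bound their number in \<open>finite_rects\<close>.\<close>

definition rects :: "'i set \<Rightarrow> ('i \<Rightarrow> 'x set set) \<Rightarrow> ('i \<Rightarrow> 'x) set set" where
  "rects I L = Pi\<^sub>E I ` Pi\<^sub>E I L"

definition rect_unions :: "'i set \<Rightarrow> ('i \<Rightarrow> 'x set set) \<Rightarrow> ('i \<Rightarrow> 'x) set set" where
  "rect_unions I L = {\<Union>F | F. finite F \<and> F \<subseteq> rects I L}"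

lemma PiE_in_rects: "(\<And>i. i \<in> I \<Longrightarrow> U i \<in> L i) \<Longrightarrow> Pi\<^sub>E I U \<in> rects I L"
proof -
  assume "\<And>i. i \<in> I \<Longrightarrow> U i \<in> L i"
  then have "restrict U I \<in> Pi\<^sub>E I L" by auto
  moreover have "Pi\<^sub>E I U = Pi\<^sub>E I (restrict U I)"
    by (rule PiE_cong) simp
  ultimately show ?thesis unfolding rects_def by blast
qed

lemma rectsE:
  assumes "R \<in> rects I L"
  obtains U where "R = Pi\<^sub>E I U" "\<And>i. i \<in> I \<Longrightarrow> U i \<in> L i"
  using assms unfolding rects_def by (auto simp: PiE_def)

lemma finite_rects:
  assumes "finite I" "\<And>i. i \<in> I \<Longrightarrow> finite (L i)"
  shows "finite (rects I L)"
  unfolding rects_def using assms by (intro finite_imageI finite_PiE)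

lemma rects_mono: "(\<And>i. i \<in> I \<Longrightarrow> L i \<subseteq> M i) \<Longrightarrow> rects I L \<subseteq> rects I M"
  by (auto elim!: rectsE intro!: PiE_in_rects)

lemma rect_unions_mono: "(\<And>i. i \<in> I \<Longrightarrow> L i \<subseteq> M i) \<Longrightarrow> rect_unions I L \<subseteq> rect_unions I M"
  using rects_mono[of I L M] unfolding rect_unions_def by blast

lemma rects_Int:
  assumes "\<And>i U V. i \<in> I \<Longrightarrow> U \<in> L i \<Longrightarrow> V \<in> L i \<Longrightarrow> U \<inter> V \<in> L i"
    and "P \<in> rects I L" "Q \<in> rects I L"
  shows "P \<inter> Q \<in> rects I L"
proof -
  obtain U where "P = Pi\<^sub>E I U" "\<And>i. i \<in> I \<Longrightarrow> U i \<in> L i"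
    using assms(2) by (rule rectsE) (rule that)
  moreover obtain V where "Q = Pi\<^sub>E I V" "\<And>i. i \<in> I \<Longrightarrow> V i \<in> L i"
    using assms(3) by (rule rectsE) (rule that)
  ultimately show ?thesis
    using assms(1) by (simp add: PiE_Int PiE_in_rects)
qed

lemma rects_subset_rect_unions: "rects I L \<subseteq> rect_unions I L"
proof
  fix R assume "R \<in> rects I L"
  then show "R \<in> rect_unions I L"
    unfolding rect_unions_def by (intro CollectI exI[of _ "{R}"]) simp
qed

text \<open>Rectangles intersect side by side, so distributivity gives closure of the finite unions
  under intersection.\<close>

lemma bounded_sublattice_rect_unions:
  assumes L: "\<And>i. i \<in> I \<Longrightarrow> bounded_sublattice (X i) (L i)"
  shows "bounded_sublattice (Pi\<^sub>E I X) (rect_unions I L)"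
proof -
  have rect: "P \<subseteq> Pi\<^sub>E I X" if "P \<in> rects I L" for P
    using that
  proof (rule rectsE)
    fix U assume U: "P = Pi\<^sub>E I U" "\<And>i. i \<in> I \<Longrightarrow> U i \<in> L i"
    show ?thesis
      unfolding U(1)
    proof (rule PiE_mono)
      fix i assume "i \<in> I"
      then show "U i \<subseteq> X i"
        using L[of i] U(2)[of i] by (auto simp: bounded_sublattice_def)
    qed
  qed
  have "rect_unions I L \<subseteq> Pow (Pi\<^sub>E I X)"
  proof
    fix W assume "W \<in> rect_unions I L"
    then obtain F where "F \<subseteq> rects I L" "W = \<Union>F"
      unfolding rect_unions_def by blast
    then show "W \<in> Pow (Pi\<^sub>E I X)"
      using rect by auto
  qed
  moreover have "{} \<in> rect_unions I L"
    unfolding rect_unions_def by blast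
  moreover have "Pi\<^sub>E I X \<in> rect_unions I L"
    using L by (intro subsetD[OF rects_subset_rect_unions] PiE_in_rects) (auto simp: bounded_sublattice_def)
  moreover have "U \<union> V \<in> rect_unions I L \<and> U \<inter> V \<in> rect_unions I L"
    if UV: "U \<in> rect_unions I L" "V \<in> rect_unions I L" for U V
  proof -
    obtain F G where FG: "finite F" "F \<subseteq> rects I L" "U = \<Union>F"
      "finite G" "G \<subseteq> rects I L" "V = \<Union>G"
      using UV unfolding rect_unions_def by blast
    have "U \<union> V = \<Union>(F \<union> G)" "finite (F \<union> G)" "F \<union> G \<subseteq> rects I L"
      using FG by auto
    moreover define H where "H = (\<lambda>(P, Q). P \<inter> Q) ` (F \<times> G)"
    have "U \<inter> V = \<Union>H" "finite H"
      using FG by (auto simp: H_def)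
    moreover have "H \<subseteq> rects I L"
      using FG L unfolding H_def by (auto simp: bounded_sublattice_def intro!: rects_Int)
    ultimately show ?thesis
      unfolding rect_unions_def by blast
  qed
  ultimately show ?thesis
    by (simp add: bounded_sublattice_def)
qed

text \<open>Each side of a rectangle inside \<open>W\<close> can be enlarged to an intersection of one-dimensional
  sections of \<open>W\<close>. There are only finitely many sections and all of them are open members of the
  lattice, so a maximal rectangle around a given point is an open one.\<close>

lemma open_rect_unions:
  assumes fin: "finite I"
    and L: "\<And>i. i \<in> I \<Longrightarrow> bounded_sublattice (topspace (T i)) (L i)"
    and W: "W \<in> rect_unions I L" and op: "openin (product_topology T I) W"
  shows "W \<in> rect_unions I (\<lambda>i. {U. openin (T i) U} \<inter> L i)"
proof -
  define E where "E = (\<Pi>\<^sub>E i\<in>I. topspace (T i))"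
  have WE: "W \<subseteq> E"
    using openin_subset[OF op] by (simp add: E_def)
  obtain F where F: "finite F" "F \<subseteq> rects I L" "W = \<Union>F"
    using W unfolding rect_unions_def by blast
  have "\<forall>R\<in>F. \<exists>U. R = Pi\<^sub>E I U \<and> (\<forall>i\<in>I. U i \<in> L i)"
    using F(2) by (meson rectsE subsetD)
  then obtain side where side': "\<forall>R\<in>F. R = Pi\<^sub>E I (side R) \<and> (\<forall>i\<in>I. side R i \<in> L i)"
    using bchoice[of F "\<lambda>R U. R = Pi\<^sub>E I U \<and> (\<forall>i\<in>I. U i \<in> L i)"] by blast
  have side: "R = Pi\<^sub>E I (side R)" "i \<in> I \<Longrightarrow> side R i \<in> L i" if "R \<in> F" for R i
    using bspec[OF side' that] by blast+
  have LX: "U \<subseteq> topspace (T i)" if "i \<in> I" "U \<in> L i" for i U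
    using L[OF that(1)] that(2) by (auto simp: bounded_sublattice_def)
  define sec where "sec = (\<lambda>i b. {y \<in> topspace (T i). b(i := y) \<in> W})"
  \<comment> \<open>A rectangle meets the line through \<open>b\<close> in direction
    \<open>i\<close> either not at all or in its full \<open>i\<close>-th side. A section is
    therefore determined by a subset of \<open>F\<close>, which yields both its definability and the
    finiteness of \<open>Secs i\<close>.\<close>
  have sec_eq: "sec i b = \<Union>((\<lambda>R. side R i) ` {R \<in> F. \<forall>j\<in>I - {i}. b j \<in> side R j})"
    if "i \<in> I" "b \<in> E" for i b
  proof -
    have mem: "b(i := y) \<in> R \<longleftrightarrow> y \<in> side R i \<and> (\<forall>j\<in>I - {i}. b j \<in> side R j)"
      if "R \<in> F" for R y
    proof -
      have "b(i := y) \<in> Pi\<^sub>E I (side R) \<longleftrightarrow>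
          y \<in> side R i \<and> (\<forall>j\<in>I - {i}. b j \<in> side R j)"
        using \<open>i \<in> I\<close> \<open>b \<in> E\<close> unfolding E_def PiE_iff extensional_def
        by (auto split: if_splits)
      then show ?thesis
        by (simp only: side(1)[OF \<open>R \<in> F\<close>, symmetric])
    qed
    have sub: "side R i \<subseteq> topspace (T i)" if "R \<in> F" for R
      using LX \<open>i \<in> I\<close> side(2)[OF that] by blast
    show ?thesis
    proof (intro equalityI subsetI)
      fix y assume "y \<in> sec i b"
      then obtain R where "R \<in> F" "b(i := y) \<in> R"
        unfolding sec_def F(3) by blast
      then show "y \<in> \<Union>((\<lambda>R. side R i) ` {R \<in> F. \<forall>j\<in>I - {i}. b j \<in> side R j})"
        using mem by blast
    next
      fix y assume "y \<in> \<Union>((\<lambda>R. side R i) ` {R \<in> F. \<forall>j\<in>I - {i}. b j \<in> side R j})"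
      then obtain R where R: "R \<in> F" "y \<in> side R i" "\<forall>j\<in>I - {i}. b j \<in> side R j"
        by blast
      then have "b(i := y) \<in> R"
        using mem by blast
      then show "y \<in> sec i b"
        using R sub[OF R(1)] unfolding sec_def F(3) by blast
    qed
  qed
  define Secs where "Secs = (\<lambda>i. sec i ` E)"
  have finSecs: "finite (Secs i)" if "i \<in> I" for i
  proof -
    have "Secs i \<subseteq> (\<lambda>G. \<Union>((\<lambda>R. side R i) ` G)) ` Pow F"
      unfolding Secs_def using sec_eq[OF that] by auto
    then show ?thesis
      using F(1) finite_subset by blast
  qed
  have Secs: "S \<in> L i \<and> openin (T i) S" if "i \<in> I" "S \<in> Secs i" for i S
  proof -
    obtain b where b: "b \<in> E" "S = sec i b"
      using \<open>S \<in> Secs i\<close> unfolding Secs_def by blast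
    have "sec i b \<in> L i"
      unfolding sec_eq[OF that(1) b(1)] using F(1) side(2) that(1)
      by (intro bounded_sublattice_Union[OF L]) auto
    moreover have "continuous_map (T i) (product_topology T I) (\<lambda>y. b(i := y))"
    proof -
      have "continuous_map (T i) (T j) (\<lambda>y. (b(i := y)) j)" if "j \<in> I" for j
        using that b(1) by (cases "j = i") (auto simp: E_def)
      moreover have "(\<lambda>y. b(i := y)) \<in> topspace (T i) \<rightarrow> extensional I"
        using b(1) that(1) by (auto simp: E_def PiE_iff extensional_def)
      ultimately show ?thesis
        by (auto simp: continuous_map_componentwise)
    qed
    then have "openin (T i) (sec i b)"
      unfolding sec_def using op by (rule openin_continuous_map_preimage)
    ultimately show ?thesis
      using b by simp
  qed
  \<comment> \<open>\<open>G \<noteq> {}\<close> is required because \<open>\<Inter>{}\<close> is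
    the whole type and need not belong to \<open>L i\<close>.\<close>
  define K where "K = (\<lambda>i. {\<Inter>G | G. G \<subseteq> Secs i \<and> G \<noteq> {}})"
  have finK: "finite (K i)" if "i \<in> I" for i
  proof -
    have "K i \<subseteq> Inter ` Pow (Secs i)"
      by (auto simp: K_def)
    then show ?thesis
      using finSecs[OF that] finite_subset by blast
  qed
  have K: "S \<in> {U. openin (T i) U} \<inter> L i" if "i \<in> I" "S \<in> K i" for i S
  proof -
    obtain G where G: "G \<subseteq> Secs i" "G \<noteq> {}" "S = \<Inter>G"
      using \<open>S \<in> K i\<close> unfolding K_def by blast
    moreover have "finite G"
      using finSecs[OF that(1)] G(1) finite_subset by blast
    moreover have "G \<subseteq> L i"
      using G(1) Secs that(1) by blast
    ultimately have "S \<in> L i"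
      using bounded_sublattice_Inter[OF L[OF that(1)]] by simp
    moreover have "openin (T i) S"
      unfolding G(3) using \<open>finite G\<close> G(1,2) Secs[OF that(1)] by (intro openin_Inter) blast+
    ultimately show ?thesis
      by simp
  qed
  \<comment> \<open>A finite pool in which to maximize: the original sides supply a first rectangle
    around each point of \<open>W\<close>, and the sides from \<open>K\<close> are the candidates
    for enlarging it.\<close>
  define D where "D = rects I (\<lambda>i. K i \<union> (\<lambda>R. side R i) ` F)"
  have finD: "finite D"
    unfolding D_def using fin finK F(1) by (intro finite_rects) auto
  have key: "\<exists>R\<in>rects I K. x \<in> R \<and> R \<subseteq> W" if "x \<in> W" for x
  proof -
    define C where "C = {R \<in> D. x \<in> R \<and> R \<subseteq> W}"
    obtain R0 where "R0 \<in> F" "x \<in> R0"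
      using \<open>x \<in> W\<close> F(3) by blast
    have "Pi\<^sub>E I (side R0) \<in> D"
      unfolding D_def using \<open>R0 \<in> F\<close> by (intro PiE_in_rects) blast
    then have "R0 \<in> D"
      by (simp only: side(1)[OF \<open>R0 \<in> F\<close>, symmetric])
    then have "R0 \<in> C"
      unfolding C_def using \<open>R0 \<in> F\<close> \<open>x \<in> R0\<close> F(3) by blast
    then obtain R where R: "R \<in> C" and max: "\<And>Q. Q \<in> C \<Longrightarrow> R \<subseteq> Q \<Longrightarrow> R = Q"
      using finite_has_maximal2[of C R0] finD unfolding C_def by auto
    obtain U where U: "R = Pi\<^sub>E I U" "\<And>i. i \<in> I \<Longrightarrow> U i \<in> K i \<union> (\<lambda>R. side R i) ` F"
      using R unfolding C_def D_def by (auto elim: rectsE)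
    have "U i \<in> K i" if i: "i \<in> I" for i
    proof -
      \<comment> \<open>Those \<open>y\<close> to which the \<open>i\<close>-th coordinate of every
        point of \<open>R\<close> can be moved without leaving \<open>W\<close>: the largest
        \<open>i\<close>-th side that the other sides of \<open>R\<close> allow.\<close>
      define V where "V = \<Inter>(sec i ` R)"
      have "R \<subseteq> E" "x \<in> R" "R \<subseteq> W"
        using R WE by (auto simp: C_def)
      then have VK: "V \<in> K i"
        unfolding K_def V_def Secs_def by blast
      have "V \<subseteq> topspace (T i)"
        using K[OF i VK] openin_subset by blast
      have "U i \<subseteq> V"
      proof
        fix y assume y: "y \<in> U i"
        have "U i \<subseteq> topspace (T i)"
          using U(2)[OF i] K[OF i] side(2) i LX[OF i] by blast
        moreover have "b(i := y) \<in> R" if "b \<in> R" for b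
          using that y i by (auto simp: U(1) PiE_iff extensional_def)
        ultimately show "y \<in> V"
          unfolding V_def sec_def using y \<open>R \<subseteq> W\<close> by blast
      qed
      have RQ: "R \<subseteq> Pi\<^sub>E I (U(i := V))"
        unfolding U(1) using \<open>U i \<subseteq> V\<close> by (intro PiE_mono) auto
      have "Pi\<^sub>E I (U(i := V)) \<subseteq> W"
      proof
        fix c assume c: "c \<in> Pi\<^sub>E I (U(i := V))"
        \<comment> \<open>Resetting coordinate \<open>i\<close> to \<open>x i\<close> brings
          \<open>c\<close> back into \<open>R\<close>; undoing the change is harmless because
          \<open>c i\<close> lies in \<open>V\<close>.\<close>
        define b where "b = c(i := x i)"
        have "b \<in> R"
          using c \<open>x \<in> R\<close> i by (auto simp: U(1) b_def PiE_iff extensional_def split: if_splits)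
        moreover have "c i \<in> V"
          using c i by (auto simp: PiE_iff dest: bspec[of _ _ i])
        ultimately have "b(i := c i) \<in> W"
          unfolding V_def sec_def by blast
        then show "c \<in> W"
          by (simp add: b_def)
      qed
      moreover have "Pi\<^sub>E I (U(i := V)) \<in> D"
        unfolding D_def using U(2) VK by (intro PiE_in_rects) auto
      ultimately have "R = Pi\<^sub>E I (U(i := V))"
        using max[OF _ RQ] RQ \<open>x \<in> R\<close> unfolding C_def by blast
      \<comment> \<open>A non-empty rectangle determines its sides, and \<open>x\<close> witnesses
        non-emptiness.\<close>
      then have "U i = V"
        using \<open>x \<in> R\<close> i PiE_eq_iff_not_empty[of I U "U(i := V)"] U(1)
        by (metis (no_types, lifting) PiE_eq_empty_iff empty_iff fun_upd_same)
      then show ?thesis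
        using VK by simp
    qed
    then have "R \<in> rects I K"
      unfolding U(1) by (rule PiE_in_rects)
    then show ?thesis
      using R unfolding C_def by blast
  qed
  then have "W = \<Union>{R \<in> rects I K. R \<subseteq> W}"
    by blast
  moreover have "finite {R \<in> rects I K. R \<subseteq> W}"
    using finite_rects[OF fin, of K] finK by simp
  moreover have "rects I K \<subseteq> rects I (\<lambda>i. {U. openin (T i) U} \<inter> L i)"
    using K by (intro rects_mono) blast
  ultimately show ?thesis
    unfolding rect_unions_def by blast
qed

section \<open>Finite products of pre-spectral spaces\<close>

lemma openin_prespectral_contains_compact_open:
  assumes "prespectral T" "openin T U" "x \<in> U"
  obtains V where "V \<in> compact_opens T" "x \<in> V" "V \<subseteq> U"
proof -
  have lat: "bounded_sublattice (topspace T) (compact_opens T)"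
    and "topology_generated_by (compact_opens T) = T"
    using assms(1) by (simp_all add: prespectral_def)
  then have "\<exists>F\<subseteq>compact_opens T. U = \<Union>F"
    using openin_generated_by_lattice_iff[OF lat, of U] assms(2) by simp
  then obtain F where "F \<subseteq> compact_opens T" "U = \<Union>F"
    by auto
  then show thesis
    using that \<open>x \<in> U\<close> by blast
qed

context
  fixes I :: "'i set" and S :: "'i \<Rightarrow> 'x topology"
  assumes fin: "finite I" and pre: "\<And>i. i \<in> I \<Longrightarrow> prespectral (S i)"
begin

text \<open>Tychonoff, in the form \<open>compactin_PiE\<close>, makes boxes with compact sides
  compact; since \<open>I\<close> is finite, boxes with open sides are open.\<close>

lemma rect_unions_compact_open:
  assumes "W \<in> rect_unions I (\<lambda>i. compact_opens (S i))"
  shows "W \<in> compact_opens (product_topology S I)"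
proof -
  have "openin (product_topology S I) R \<and> compactin (product_topology S I) R"
    if "R \<in> rects I (\<lambda>i. compact_opens (S i))" for R
    using that fin
    by (auto elim!: rectsE simp: compact_opens_def compactin_PiE intro!: product_topology_basis'
        openin_PiE_gen[THEN iffD2])
  then show ?thesis
    using assms unfolding compact_opens_def rect_unions_def by (auto intro!: compactin_Union)
qed

text \<open>Inside a basic box around a point, each side shrinks to a compact open neighbourhood of
  the corresponding coordinate.\<close>

lemma product_topology_generated_by_rect_unions:
  "product_topology S I = topology_generated_by (rect_unions I (\<lambda>i. compact_opens (S i)))"
proof -
  let ?R = "rects I (\<lambda>i. compact_opens (S i))"
  let ?RU = "rect_unions I (\<lambda>i. compact_opens (S i))"
  have lat: "bounded_sublattice (\<Pi>\<^sub>E i\<in>I. topspace (S i)) ?RU"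
    using pre by (intro bounded_sublattice_rect_unions) (auto simp: prespectral_def)
  have "openin (topology_generated_by ?RU) U" if U: "openin (product_topology S I) U" for U
  proof -
    have "\<exists>R\<in>?R. x \<in> R \<and> R \<subseteq> U" if x: "x \<in> U" for x
    proof -
      obtain O' where O': "x \<in> Pi\<^sub>E I O'" "\<And>i. openin (S i) (O' i)" "Pi\<^sub>E I O' \<subseteq> U"
        using product_topology_open_contains_basis[OF U x] by blast
      have "\<forall>i\<in>I. \<exists>V. V \<in> compact_opens (S i) \<and> x i \<in> V \<and> V \<subseteq> O' i"
      proof
        fix i assume i: "i \<in> I"
        then have "x i \<in> O' i" using O'(1) by (auto simp: PiE_iff)
        then show "\<exists>V. V \<in> compact_opens (S i) \<and> x i \<in> V \<and> V \<subseteq> O' i"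
          using openin_prespectral_contains_compact_open[OF pre[OF i] O'(2)[of i]] by metis
      qed
      then obtain V where V: "\<forall>i\<in>I. V i \<in> compact_opens (S i) \<and> x i \<in> V i \<and> V i \<subseteq> O' i"
        using bchoice[of I "\<lambda>i V. V \<in> compact_opens (S i) \<and> x i \<in> V \<and> V \<subseteq> O' i"] by auto
      have "x \<in> Pi\<^sub>E I V" "Pi\<^sub>E I V \<subseteq> Pi\<^sub>E I O'"
        using V O'(1) by (auto simp: PiE_iff intro!: PiE_mono)
      moreover have "Pi\<^sub>E I V \<in> ?R"
        using V by (intro PiE_in_rects) blast
      ultimately show ?thesis
        using O'(3) by (intro bexI[of _ "Pi\<^sub>E I V"]) auto
    qed
    then have "U = \<Union>{R \<in> ?R. R \<subseteq> U}"
      by blast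
    moreover have "{R \<in> ?R. R \<subseteq> U} \<subseteq> ?RU"
      using rects_subset_rect_unions by blast
    ultimately show ?thesis
      unfolding openin_generated_by_lattice_iff[OF lat] by blast
  qed
  moreover have "openin (product_topology S I) U" if "openin (topology_generated_by ?RU) U" for U
    using that rect_unions_compact_open unfolding openin_generated_by_lattice_iff[OF lat]
    by (auto simp: compact_opens_def intro!: openin_Union)
  ultimately show ?thesis
    unfolding topology_eq by blast
qed

lemma compact_opens_product_topology:
  "compact_opens (product_topology S I) = rect_unions I (\<lambda>i. compact_opens (S i))"
  and prespectral_product_topology: "prespectral (product_topology S I)"
proof -
  have lat: "bounded_sublattice (\<Pi>\<^sub>E i\<in>I. topspace (S i)) (rect_unions I (\<lambda>i. compact_opens (S i)))"
    using pre by (intro bounded_sublattice_rect_unions) (auto simp: prespectral_def)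
  have "compactin (product_topology S I) U"
    if "U \<in> rect_unions I (\<lambda>i. compact_opens (S i))" for U
    using rect_unions_compact_open[OF that] by (simp add: compact_opens_def)
  note cpt = this[unfolded product_topology_generated_by_rect_unions]
  show "compact_opens (product_topology S I) = rect_unions I (\<lambda>i. compact_opens (S i))"
    using compact_opens_generated_by_lattice[OF lat cpt]
    by (simp add: product_topology_generated_by_rect_unions)
  show "prespectral (product_topology S I)"
    using prespectral_generated_by_lattice[OF lat cpt]
    by (simp add: product_topology_generated_by_rect_unions)
qed

section \<open>Universal property of the finite product\<close>

lemma spectral_map_into_product_topology:
  assumes Z: "prespectral Z" and g: "\<And>i. i \<in> I \<Longrightarrow> spectral_map Z (S i) (\<lambda>z. h z i)"
    and ext: "\<And>z. z \<in> topspace Z \<Longrightarrow> h z \<in> extensional I"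
  shows "spectral_map Z (product_topology S I) h"
proof -
  have Zlat: "bounded_sublattice (topspace Z) (compact_opens Z)"
    using Z by (simp add: prespectral_def)
  have "continuous_map Z (product_topology S I) h"
    using g ext by (auto simp: continuous_map_componentwise spectral_map_def)
  moreover have "{z \<in> topspace Z. h z \<in> W} \<in> compact_opens Z"
    if W: "W \<in> compact_opens (product_topology S I)" for W
  proof -
    have rect: "{z \<in> topspace Z. h z \<in> R} \<in> compact_opens Z"
      if R: "R \<in> rects I (\<lambda>i. compact_opens (S i))" for R
    proof -
      obtain U where U: "R = Pi\<^sub>E I U" "\<And>i. i \<in> I \<Longrightarrow> U i \<in> compact_opens (S i)"
        using R by (rule rectsE) (rule that)
      \<comment> \<open>The preimage of a rectangle is a finite intersection of coordinate
        preimages. Inserting \<open>topspace Z\<close>, which is compact open as \<open>Z\<close> is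
        pre-spectral, covers the case of empty \<open>I\<close>.\<close>
      have "{z \<in> topspace Z. h z \<in> R}
          = \<Inter>(insert (topspace Z) ((\<lambda>i. {z \<in> topspace Z. h z i \<in> U i}) ` I))"
        using ext by (auto simp: U(1) PiE_iff)
      also have "\<dots> \<in> compact_opens Z"
        using fin g U(2) Zlat
        by (intro bounded_sublattice_Inter[OF Zlat]) (auto simp: spectral_map_def bounded_sublattice_def)
      finally show ?thesis .
    qed
    obtain F where F: "finite F" "F \<subseteq> rects I (\<lambda>i. compact_opens (S i))" "W = \<Union>F"
      using W unfolding compact_opens_product_topology rect_unions_def by blast
    have "{z \<in> topspace Z. h z \<in> W} = \<Union>((\<lambda>R. {z \<in> topspace Z. h z \<in> R}) ` F)"
      using F(3) by blast
    also have "\<dots> \<in> compact_opens Z"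
      using F rect by (intro bounded_sublattice_Union[OF Zlat]) auto
    finally show ?thesis .
  qed
  ultimately show ?thesis
    by (simp add: spectral_map_def)
qed

text \<open>The preimage of \<open>U\<close> is the rectangle with side \<open>U\<close> at
  \<open>i\<close> and full sides elsewhere; full sides are compact open because pre-spectral spaces
  are compact.\<close>

lemma spectral_map_projection:
  assumes i: "i \<in> I"
  shows "spectral_map (product_topology S I) (S i) (\<lambda>x. x i)"
proof -
  have "{x \<in> topspace (product_topology S I). x i \<in> U} \<in> compact_opens (product_topology S I)"
    if U: "U \<in> compact_opens (S i)" for U
  proof -
    let ?V = "\<lambda>j. if j = i then U else topspace (S j)"
    have "U \<subseteq> topspace (S i)"
      using U by (auto simp: compact_opens_def openin_subset)
    then have "Pi\<^sub>E I ?V \<subseteq> topspace (product_topology S I)"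
      unfolding topspace_product_topology by (intro PiE_mono) simp
    moreover have "x i \<in> U" if "x \<in> Pi\<^sub>E I ?V" for x
      using PiE_mem[OF that i] by simp
    moreover have "x \<in> Pi\<^sub>E I ?V" if "x \<in> topspace (product_topology S I)" "x i \<in> U" for x
      using that by (simp add: PiE_iff)
    ultimately have "{x \<in> topspace (product_topology S I). x i \<in> U} = Pi\<^sub>E I ?V"
      by blast
    moreover have "Pi\<^sub>E I ?V \<in> rects I (\<lambda>i. compact_opens (S i))"
      using U pre by (intro PiE_in_rects) (auto simp: prespectral_def bounded_sublattice_def)
    ultimately show ?thesis
      unfolding compact_opens_product_topology
      using rects_subset_rect_unions[of I "\<lambda>i. compact_opens (S i)"] by (simp only: subsetD)
  qed
  then show ?thesis
    using i by (simp add: spectral_map_def continuous_map_product_projection)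
qed

theorem PreSpec_product_product_topology:
  "PreSpec_product TYPE('z) I S (product_topology S I) (\<lambda>i x. x i)"
  unfolding PreSpec_product_def
proof (intro conjI allI impI ballI)
  fix Z :: "'z topology" and g
  assume "prespectral Z \<and> (\<forall>i\<in>I. spectral_map Z (S i) (g i))"
  then have Z: "prespectral Z" and g: "\<And>i. i \<in> I \<Longrightarrow> spectral_map Z (S i) (g i)"
    by auto
  \<comment> \<open>The outer restriction provides the extensionality demanded for uniqueness; the
    inner one places the values in \<open>\<Pi>\<^sub>E\<close>.\<close>
  define h where "h = (\<lambda>z\<in>topspace Z. \<lambda>i\<in>I. g i z)"
  have "spectral_map Z (S i) (\<lambda>z. h z i)" if "i \<in> I" for i
  proof -
    have *: "h z i = g i z" if "z \<in> topspace Z" for z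
      using that \<open>i \<in> I\<close> by (simp add: h_def)
    then have "{z \<in> topspace Z. h z i \<in> U} = {z \<in> topspace Z. g i z \<in> U}" for U
      by auto
    moreover have "continuous_map Z (S i) (\<lambda>z. h z i)"
      using g[OF that] * by (auto simp: spectral_map_def intro: continuous_map_eq)
    ultimately show ?thesis
      using g[OF that] by (simp add: spectral_map_def)
  qed
  then have h: "spectral_map Z (product_topology S I) h"
    by (intro spectral_map_into_product_topology[OF Z]) (auto simp: h_def)
  show "\<exists>!h. h \<in> extensional (topspace Z) \<and> spectral_map Z (product_topology S I) h \<and>
      (\<forall>i\<in>I. \<forall>z\<in>topspace Z. h z i = g i z)"
  proof (rule ex1I[of _ h])
    show "h \<in> extensional (topspace Z) \<and> spectral_map Z (product_topology S I) h \<and>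
      (\<forall>i\<in>I. \<forall>z\<in>topspace Z. h z i = g i z)"
      using h by (simp add: h_def)
  next
    fix k assume k: "k \<in> extensional (topspace Z) \<and> spectral_map Z (product_topology S I) k \<and>
      (\<forall>i\<in>I. \<forall>z\<in>topspace Z. k z i = g i z)"
    show "k = h"
    proof (rule extensionalityI[of _ "topspace Z"])
      fix z assume z: "z \<in> topspace Z"
      \<comment> \<open>Points of the product space are extensional on \<open>I\<close>, so
        \<open>k z\<close> is determined by its coordinates.\<close>
      then have "k z \<in> topspace (product_topology S I)"
        using k by (meson continuous_map_image_subset_topspace image_subset_iff spectral_map_def)
      then have "k z \<in> extensional I"
        by (simp add: PiE_iff)
      then show "k z = h z"
        using k z by (intro extensionalityI[of _ I]) (auto simp: h_def)
    qed (use k in \<open>auto simp: h_def\<close>)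
  qed
qed (use pre prespectral_product_topology spectral_map_projection in auto)

end

section \<open>First-order definable sets\<close>

lemma sat_cong: "(\<And>x. x \<in> free_vars \<phi> \<Longrightarrow> \<nu> x = \<mu> x) \<Longrightarrow> sat A \<nu> \<phi> \<longleftrightarrow> sat A \<mu> \<phi>"
proof (induction \<phi> arbitrary: \<nu> \<mu>)
  case (FRel r xs)
  then have "map \<nu> xs = map \<mu> xs" by simp
  then show ?case by (simp only: sat.simps)
next
  case (FConj \<phi> \<psi>)
  have "sat A \<nu> \<phi> \<longleftrightarrow> sat A \<mu> \<phi>"
    by (rule FConj.IH) (use FConj.prems in auto)
  moreover have "sat A \<nu> \<psi> \<longleftrightarrow> sat A \<mu> \<psi>"
    by (rule FConj.IH) (use FConj.prems in auto)
  ultimately show ?case by simp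
next
  case (FEx x \<phi>)
  have "sat A (\<nu>(x := a)) \<phi> \<longleftrightarrow> sat A (\<mu>(x := a)) \<phi>" for a
    by (rule FEx.IH) (use FEx.prems in auto)
  then show ?case by simp
next
  case (FNeg \<phi>)
  have "sat A \<nu> \<phi> \<longleftrightarrow> sat A \<mu> \<phi>"
    by (rule FNeg.IH) (use FNeg.prems in auto)
  then show ?case by simp
qed auto

lemma models_iff_sat: "free_vars \<phi> = {} \<Longrightarrow> models A \<phi> \<longleftrightarrow> sat A \<nu> \<phi>"
  unfolding models_def using sat_cong by blast

text \<open>A sentence, unlike \<open>FEq 0 0\<close>, and true in the empty structure as well.\<close>

definition FTrue :: "'r fm" where
  "FTrue = FNeg (FEx 0 (FNeg (FEq 0 0)))"

lemma FTrue_simps [simp]: "sat A \<nu> FTrue" "free_vars FTrue = {}" "is_formula \<sigma> FTrue"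
  by (auto simp: FTrue_def)

text \<open>For a formula with free variables, \<open>models\<close> expresses its universal closure
  and does not commute with negation; sentences avoid this, since one assignment decides
  them.\<close>

lemma FO_sets_Compl:
  assumes "U \<in> FO_sets \<sigma> X"
  shows "X - U \<in> FO_sets \<sigma> X"
proof -
  obtain \<phi> where \<phi>: "U = {A \<in> X. models A \<phi>}" "is_sentence \<sigma> \<phi>"
    using assms by (auto simp: FO_sets_def)
  then have "X - U = {A \<in> X. models A (FNeg \<phi>)}"
    using models_iff_sat[of \<phi>] models_iff_sat[of "FNeg \<phi>"] by (auto simp: is_sentence_def)
  then show ?thesis
    using \<phi>(2) unfolding FO_sets_def is_sentence_def
    by (auto intro!: exI[of _ "FNeg \<phi>"])
qed

lemma FO_sets_Int:
  assumes "U \<in> FO_sets \<sigma> X" "V \<in> FO_sets \<sigma> X"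
  shows "U \<inter> V \<in> FO_sets \<sigma> X"
proof -
  obtain \<phi> \<psi> where \<phi>: "U = {A \<in> X. models A \<phi>}" "is_sentence \<sigma> \<phi>"
    and \<psi>: "V = {A \<in> X. models A \<psi>}" "is_sentence \<sigma> \<psi>"
    using assms by (auto simp: FO_sets_def)
  then have "U \<inter> V = {A \<in> X. models A (FConj \<phi> \<psi>)}"
    by (auto simp: models_def)
  then show ?thesis
    using \<phi>(2) \<psi>(2) unfolding FO_sets_def is_sentence_def
    by (auto intro!: exI[of _ "FConj \<phi> \<psi>"])
qed

lemma bounded_sublattice_FO_sets: "bounded_sublattice X (FO_sets \<sigma> X)"
proof -
  have X: "X \<in> FO_sets \<sigma> X"
    unfolding FO_sets_def by (auto intro!: exI[of _ FTrue] simp: models_def is_sentence_def)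
  have sub: "FO_sets \<sigma> X \<subseteq> Pow X"
    by (auto simp: FO_sets_def)
  have "U \<union> V \<in> FO_sets \<sigma> X" if "U \<in> FO_sets \<sigma> X" "V \<in> FO_sets \<sigma> X" for U V
  proof -
    have "U \<union> V = X - ((X - U) \<inter> (X - V))"
      using that sub by blast
    then show ?thesis
      using that by (simp add: FO_sets_Compl FO_sets_Int)
  qed
  moreover have "{} \<in> FO_sets \<sigma> X"
    using FO_sets_Compl[OF X] by simp
  ultimately show ?thesis
    using X sub FO_sets_Int unfolding bounded_sublattice_def by blast
qed

section \<open>The Feferman--Vaught theorem for disjoint unions\<close>

text \<open>\<open>P\<close> is a finite disjunction of conjunctions with one conjunct \<open>\<psi> i\<close> for each component;
  \<open>V i\<close> bounds the free variables of the \<open>i\<close>-th conjuncts.\<close>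

definition separable :: "'i set \<Rightarrow> ('i \<Rightarrow> 'r signature) \<Rightarrow> ('i \<Rightarrow> nat set) \<Rightarrow>
    (('i \<Rightarrow> ('r, 'a) struct) \<Rightarrow> (nat \<Rightarrow> 'a) \<Rightarrow> bool) \<Rightarrow> bool" where
  "separable I \<sigma> V P \<longleftrightarrow>
     (\<exists>K. finite K \<and>
        (\<forall>\<psi>\<in>K. \<forall>i\<in>I. is_formula (\<sigma> i) (\<psi> i) \<and> free_vars (\<psi> i) \<subseteq> V i) \<and>
        P = (\<lambda>A \<mu>. \<exists>\<psi>\<in>K. \<forall>i\<in>I. sat (A i) \<mu> (\<psi> i)))"

section \<open>Closure properties of separable predicates\<close>

lemma separableI:
  assumes "finite K"
    and "\<And>\<psi> i. \<psi> \<in> K \<Longrightarrow> i \<in> I \<Longrightarrow> is_formula (\<sigma> i) (\<psi> i) \<and> free_vars (\<psi> i) \<subseteq> V i"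
    and "\<And>A \<mu>. P A \<mu> \<longleftrightarrow> (\<exists>\<psi>\<in>K. \<forall>i\<in>I. sat (A i) \<mu> (\<psi> i))"
  shows "separable I \<sigma> V P"
  unfolding separable_def using assms(1,2)
  by (intro exI[of _ K] conjI ballI ext assms(3)) blast+

lemma separableE:
  assumes "separable I \<sigma> V P"
  obtains K where "finite K"
    "\<forall>\<psi>\<in>K. \<forall>i\<in>I. is_formula (\<sigma> i) (\<psi> i) \<and> free_vars (\<psi> i) \<subseteq> V i"
    "P = (\<lambda>A \<mu>. \<exists>\<psi>\<in>K. \<forall>i\<in>I. sat (A i) \<mu> (\<psi> i))"
  using assms unfolding separable_def by (elim exE conjE)

lemma separable_mono:
  assumes "separable I \<sigma> V P" "\<And>i. i \<in> I \<Longrightarrow> V i \<subseteq> W i"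
  shows "separable I \<sigma> W P"
proof -
  obtain K where K: "finite K"
    "\<forall>\<psi>\<in>K. \<forall>i\<in>I. is_formula (\<sigma> i) (\<psi> i) \<and> free_vars (\<psi> i) \<subseteq> V i"
    "P = (\<lambda>A \<mu>. \<exists>\<psi>\<in>K. \<forall>i\<in>I. sat (A i) \<mu> (\<psi> i))"
    using assms(1) by (rule separableE)
  then show ?thesis
    using assms(2) by (intro separableI[of K]) blast+
qed

lemma separable_False: "separable I \<sigma> V (\<lambda>A \<mu>. False)"
  by (intro separableI[of "{}"]) simp_all

lemma separable_True: "separable I \<sigma> V (\<lambda>A \<mu>. True)"
  by (intro separableI[of "{\<lambda>_. FTrue}"]) simp_all

lemma separable_component:
  assumes "i \<in> I" "is_formula (\<sigma> i) \<phi>" "free_vars \<phi> \<subseteq> V i"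
  shows "separable I \<sigma> V (\<lambda>A \<mu>. sat (A i) \<mu> \<phi>)"
  using assms by (intro separableI[of "{(\<lambda>_. FTrue)(i := \<phi>)}"]) auto

lemma separable_disj:
  assumes "separable I \<sigma> V P" "separable I \<sigma> V Q"
  shows "separable I \<sigma> V (\<lambda>A \<mu>. P A \<mu> \<or> Q A \<mu>)"
proof -
  obtain K where K: "finite K"
    "\<forall>\<psi>\<in>K. \<forall>i\<in>I. is_formula (\<sigma> i) (\<psi> i) \<and> free_vars (\<psi> i) \<subseteq> V i"
    "P = (\<lambda>A \<mu>. \<exists>\<psi>\<in>K. \<forall>i\<in>I. sat (A i) \<mu> (\<psi> i))"
    using assms(1) by (rule separableE)
  obtain K' where K': "finite K'"
    "\<forall>\<psi>\<in>K'. \<forall>i\<in>I. is_formula (\<sigma> i) (\<psi> i) \<and> free_vars (\<psi> i) \<subseteq> V i"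
    "Q = (\<lambda>A \<mu>. \<exists>\<psi>\<in>K'. \<forall>i\<in>I. sat (A i) \<mu> (\<psi> i))"
    using assms(2) by (rule separableE)
  show ?thesis
    using K(1,2) K'(1,2) unfolding K(3) K'(3) by (intro separableI[of "K \<union> K'"]) blast+
qed

lemma separable_conj:
  assumes "separable I \<sigma> V P" "separable I \<sigma> V Q"
  shows "separable I \<sigma> V (\<lambda>A \<mu>. P A \<mu> \<and> Q A \<mu>)"
proof -
  obtain K where K: "finite K"
    "\<forall>\<psi>\<in>K. \<forall>i\<in>I. is_formula (\<sigma> i) (\<psi> i) \<and> free_vars (\<psi> i) \<subseteq> V i"
    "P = (\<lambda>A \<mu>. \<exists>\<psi>\<in>K. \<forall>i\<in>I. sat (A i) \<mu> (\<psi> i))"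
    using assms(1) by (rule separableE)
  obtain K' where K': "finite K'"
    "\<forall>\<psi>\<in>K'. \<forall>i\<in>I. is_formula (\<sigma> i) (\<psi> i) \<and> free_vars (\<psi> i) \<subseteq> V i"
    "Q = (\<lambda>A \<mu>. \<exists>\<psi>\<in>K'. \<forall>i\<in>I. sat (A i) \<mu> (\<psi> i))"
    using assms(2) by (rule separableE)
  \<comment> \<open>Distributing the two disjunctions: one disjunct per pair, conjoined component by
    component.\<close>
  let ?C = "(\<lambda>(\<psi>, \<psi>') i. FConj (\<psi> i) (\<psi>' i)) ` (K \<times> K')"
  show ?thesis
  proof (rule separableI[of ?C])
    fix A :: "'a \<Rightarrow> ('b, 'c) struct" and \<mu>
    have "(\<exists>\<chi>\<in>?C. \<forall>i\<in>I. sat (A i) \<mu> (\<chi> i)) \<longleftrightarrow>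
        (\<exists>\<psi>\<in>K. \<exists>\<psi>'\<in>K'. \<forall>i\<in>I. sat (A i) \<mu> (\<psi> i) \<and> sat (A i) \<mu> (\<psi>' i))"
      by simp
    then show "P A \<mu> \<and> Q A \<mu> \<longleftrightarrow> (\<exists>\<chi>\<in>?C. \<forall>i\<in>I. sat (A i) \<mu> (\<chi> i))"
      unfolding K(3) K'(3) by blast
  qed (use K(1,2) K'(1,2) in \<open>auto simp: subset_iff\<close>)
qed

lemma separable_Bex:
  assumes "finite J" "\<And>j. j \<in> J \<Longrightarrow> separable I \<sigma> V (P j)"
  shows "separable I \<sigma> V (\<lambda>A \<mu>. \<exists>j\<in>J. P j A \<mu>)"
  using assms
  by (induction rule: finite_induct) (simp_all add: separable_False separable_disj)

lemma separable_Ball: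
  assumes "finite J" "\<And>j. j \<in> J \<Longrightarrow> separable I \<sigma> V (P j)"
  shows "separable I \<sigma> V (\<lambda>A \<mu>. \<forall>j\<in>J. P j A \<mu>)"
  using assms
  by (induction rule: finite_induct) (simp_all add: separable_True separable_conj)

text \<open>By De Morgan the negation is a finite conjunction, over \<open>K\<close>, of
  disjunctions over \<open>I\<close> of statements about a single component, and the closure
  properties bring this back to normal form.\<close>

lemma separable_neg:
  assumes "finite I" "separable I \<sigma> V P"
  shows "separable I \<sigma> V (\<lambda>A \<mu>. \<not> P A \<mu>)"
proof -
  obtain K where K: "finite K"
    "\<forall>\<psi>\<in>K. \<forall>i\<in>I. is_formula (\<sigma> i) (\<psi> i) \<and> free_vars (\<psi> i) \<subseteq> V i"
    "P = (\<lambda>A \<mu>. \<exists>\<psi>\<in>K. \<forall>i\<in>I. sat (A i) \<mu> (\<psi> i))"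
    using assms(2) by (rule separableE)
  have "separable I \<sigma> V (\<lambda>A \<mu>. \<forall>\<psi>\<in>K. \<exists>i\<in>I. sat (A i) \<mu> (FNeg (\<psi> i)))"
    using K(1,2) assms(1) by (intro separable_Ball separable_Bex separable_component) auto
  then show ?thesis
    by (simp add: K(3))
qed

text \<open>The quantified element lies in the \<open>i\<close>-th component, so only the \<open>i\<close>-th conjuncts
  mention it.\<close>

lemma separable_ex_component:
  assumes "i \<in> I" "separable I \<sigma> V P" "\<And>j. j \<in> I \<Longrightarrow> j \<noteq> i \<Longrightarrow> x \<notin> V j"
  shows "separable I \<sigma> (\<lambda>j. V j - {x}) (\<lambda>A \<mu>. \<exists>a\<in>univ (A i). P A (\<mu>(x := a)))"
proof -
  obtain K where K: "finite K"
    "\<forall>\<psi>\<in>K. \<forall>i\<in>I. is_formula (\<sigma> i) (\<psi> i) \<and> free_vars (\<psi> i) \<subseteq> V i"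
    "P = (\<lambda>A \<mu>. \<exists>\<psi>\<in>K. \<forall>i\<in>I. sat (A i) \<mu> (\<psi> i))"
    using assms(2) by (rule separableE)
  define ex where "ex = (\<lambda>\<psi> :: 'a \<Rightarrow> 'b fm. \<psi>(i := FEx x (\<psi> i)))"
  have fresh: "sat (A j) (\<mu>(x := a)) (\<psi> j) \<longleftrightarrow> sat (A j) \<mu> (\<psi> j)"
    if "\<psi> \<in> K" "j \<in> I" "j \<noteq> i" for \<psi> j A \<mu> a
    by (rule sat_cong) (use that K(2) assms(3) in auto)
  show ?thesis
  proof (rule separableI[of "ex ` K"])
    fix A :: "'a \<Rightarrow> ('b, 'c) struct" and \<mu>
    have "(\<exists>a\<in>univ (A i). \<forall>j\<in>I. sat (A j) (\<mu>(x := a)) (\<psi> j)) \<longleftrightarrow>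
        (\<forall>j\<in>I. sat (A j) \<mu> (ex \<psi> j))" if "\<psi> \<in> K" for \<psi>
    proof -
      have "(\<forall>j\<in>I. sat (A j) (\<mu>(x := a)) (\<psi> j)) \<longleftrightarrow>
          sat (A i) (\<mu>(x := a)) (\<psi> i) \<and> (\<forall>j\<in>I - {i}. sat (A j) \<mu> (\<psi> j))" for a
        using fresh[OF that] assms(1) by (metis DiffD1 DiffD2 DiffI singletonD singletonI)
      moreover have "(\<forall>j\<in>I. sat (A j) \<mu> (ex \<psi> j)) \<longleftrightarrow>
          (\<exists>a\<in>univ (A i). sat (A i) (\<mu>(x := a)) (\<psi> i)) \<and> (\<forall>j\<in>I - {i}. sat (A j) \<mu> (\<psi> j))"
        using assms(1) by (auto simp: ex_def)
      ultimately show ?thesis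
        by auto
    qed
    then show "(\<exists>a\<in>univ (A i). P A (\<mu>(x := a))) \<longleftrightarrow>
        (\<exists>\<chi>\<in>ex ` K. \<forall>j\<in>I. sat (A j) \<mu> (\<chi> j))"
      unfolding K(3) by blast
  next
    fix \<chi> j assume "\<chi> \<in> ex ` K" and j: "j \<in> I"
    then obtain \<psi> where \<psi>: "\<psi> \<in> K" "\<chi> = ex \<psi>" by blast
    then show "is_formula (\<sigma> j) (\<chi> j) \<and> free_vars (\<chi> j) \<subseteq> V j - {x}"
      using K(2) j assms(3)[OF j] by (cases "j = i") (auto simp: ex_def)
  qed (use K(1) in simp)
qed

text \<open>The map \<open>c\<close> records the component in which each variable takes its value.\<close>

lemma separable_sat_disjoint_union:
  fixes \<sigma> :: "'i \<Rightarrow> 'r signature" and \<phi> :: "('i, 'r) sum_symbol fm"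
  assumes fin: "finite I"
  shows "is_formula (sum_signature I \<sigma>) \<phi> \<Longrightarrow> c ` free_vars \<phi> \<subseteq> I \<Longrightarrow>
    separable I \<sigma> (\<lambda>i. {x \<in> free_vars \<phi>. c x = i})
      (\<lambda>A (\<mu> :: nat \<Rightarrow> 'a). sat (disjoint_union_structure I A) (\<lambda>x. (c x, \<mu> x)) \<phi>)"
proof (induction \<phi> arbitrary: c)
  case (FEq x y)
  show ?case
  \<comment> \<open>Elements tagged with different components are never equal.\<close>
  proof (cases "c x = c y")
    case True
    have "separable I \<sigma> (\<lambda>i. {z \<in> free_vars (FEq x y). c z = i})
        (\<lambda>A (\<mu> :: nat \<Rightarrow> 'a). sat (A (c x)) \<mu> (FEq x y))"
      using FEq True by (intro separable_component) auto
    then show ?thesis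
      using True by simp
  qed (simp add: separable_False)
next
  case (FRel s xs)
  show ?case
  proof (cases s)
    case (Copy i r)
    have i: "i \<in> I" and r: "\<sigma> i r = Some (length xs)"
      using FRel.prems(1) by (auto simp: Copy sum_signature_def split: if_splits)
    \<comment> \<open>A tuple of a copied relation has tag \<open>i\<close> in every entry. For a
      nullary symbol this condition is vacuous and the truth value is that in
      \<open>A i\<close>.\<close>
    have eq: "sat (disjoint_union_structure I A) (\<lambda>x. (c x, \<mu> x)) (FRel s xs) \<longleftrightarrow>
        (\<forall>x\<in>set xs. c x = i) \<and> map \<mu> xs \<in> interp (A i) r" for A and \<mu> :: "nat \<Rightarrow> 'a"
    proof -
      have "map (\<lambda>x. (c x, \<mu> x)) xs = map (Pair i) t \<longleftrightarrow> (\<forall>x\<in>set xs. c x = i) \<and> map \<mu> xs = t"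
        for t
        by (induction xs arbitrary: t) (auto simp: Cons_eq_map_conv)
      then have "map (\<lambda>x. (c x, \<mu> x)) xs \<in> map (Pair i) ` interp (A i) r \<longleftrightarrow>
          (\<forall>x\<in>set xs. c x = i) \<and> map \<mu> xs \<in> interp (A i) r"
        unfolding image_iff by metis
      then show ?thesis
        using i by (simp add: Copy disjoint_union_structure_def)
    qed
    show ?thesis
    proof (cases "\<forall>x\<in>set xs. c x = i")
      case True
      have "separable I \<sigma> (\<lambda>i. {z \<in> free_vars (FRel s xs). c z = i})
          (\<lambda>A (\<mu> :: nat \<Rightarrow> 'a). sat (A i) \<mu> (FRel r xs))"
        using i r True by (intro separable_component) auto
      then show ?thesis
        unfolding eq using True by simp
    qed (simp only: eq simp_thms separable_False)
  next
    case (Mark i)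
    have i: "i \<in> I" and "length xs = 1"
      using FRel.prems(1) by (auto simp: Mark sum_signature_def split: if_splits)
    then obtain x where x: "xs = [x]"
      by (auto simp: length_Suc_conv)
    \<comment> \<open>Assignments range over the whole type, so the right tag does not suffice: the
      value must also lie in \<open>univ (A i)\<close>. The bounded quantifier expresses this, with
      \<open>Suc x\<close> as a variable other than \<open>x\<close>.\<close>
    have eq: "sat (disjoint_union_structure I A) (\<lambda>x. (c x, \<mu> x)) (FRel s xs) \<longleftrightarrow>
        c x = i \<and> sat (A i) \<mu> (FEx (Suc x) (FEq x (Suc x)))" for A and \<mu> :: "nat \<Rightarrow> 'a"
      using i by (auto simp: Mark x disjoint_union_structure_def)
    show ?thesis
    proof (cases "c x = i")
      case True
      have "separable I \<sigma> (\<lambda>i. {z \<in> free_vars (FRel s xs). c z = i})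
          (\<lambda>A (\<mu> :: nat \<Rightarrow> 'a). sat (A i) \<mu> (FEx (Suc x) (FEq x (Suc x))))"
        using i True x by (intro separable_component) auto
      then show ?thesis
        unfolding eq using True by simp
    qed (simp only: eq simp_thms separable_False)
  qed
next
  case (FNeg \<phi>)
  then show ?case
    using separable_neg[OF fin] by fastforce
next
  case (FConj \<phi> \<psi>)
  have "separable I \<sigma> (\<lambda>i. {x \<in> free_vars (FConj \<phi> \<psi>). c x = i})
      (\<lambda>A (\<mu> :: nat \<Rightarrow> 'a). sat (disjoint_union_structure I A) (\<lambda>x. (c x, \<mu> x)) \<phi>)"
    by (rule separable_mono[OF FConj.IH(1)]) (use FConj.prems in auto)
  moreover have "separable I \<sigma> (\<lambda>i. {x \<in> free_vars (FConj \<phi> \<psi>). c x = i})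
      (\<lambda>A (\<mu> :: nat \<Rightarrow> 'a). sat (disjoint_union_structure I A) (\<lambda>x. (c x, \<mu> x)) \<psi>)"
    by (rule separable_mono[OF FConj.IH(2)]) (use FConj.prems in auto)
  ultimately show ?case
    by (simp only: sat.simps separable_conj)
next
  case (FEx x \<phi>)
  \<comment> \<open>A quantifier over the disjoint union first picks a component \<open>i\<close>
    and then an element of it. The map \<open>c\<close> changes at \<open>x\<close> accordingly,
    which is why the induction keeps \<open>c\<close> arbitrary.\<close>
  have "separable I \<sigma> (\<lambda>j. {y \<in> free_vars (FEx x \<phi>). c y = j})
      (\<lambda>A (\<mu> :: nat \<Rightarrow> 'a). \<exists>i\<in>I. \<exists>a\<in>univ (A i).
        sat (disjoint_union_structure I A) (\<lambda>y. ((c(x := i)) y, (\<mu>(x := a)) y)) \<phi>)"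
  proof (rule separable_Bex[OF fin])
    fix i assume i: "i \<in> I"
    have sep: "separable I \<sigma> (\<lambda>j. {y \<in> free_vars \<phi>. (c(x := i)) y = j})
      (\<lambda>A (\<mu> :: nat \<Rightarrow> 'a).
        sat (disjoint_union_structure I A) (\<lambda>y. ((c(x := i)) y, \<mu> y)) \<phi>)"
      using FEx.prems i by (intro FEx.IH) auto
    have "separable I \<sigma> (\<lambda>j. {y \<in> free_vars \<phi>. (c(x := i)) y = j} - {x})
      (\<lambda>A (\<mu> :: nat \<Rightarrow> 'a). \<exists>a\<in>univ (A i).
        sat (disjoint_union_structure I A) (\<lambda>y. ((c(x := i)) y, (\<mu>(x := a)) y)) \<phi>)"
      using separable_ex_component[OF i sep, of x] by simp
    then show "separable I \<sigma> (\<lambda>j. {y \<in> free_vars (FEx x \<phi>). c y = j})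
      (\<lambda>A (\<mu> :: nat \<Rightarrow> 'a). \<exists>a\<in>univ (A i).
        sat (disjoint_union_structure I A) (\<lambda>y. ((c(x := i)) y, (\<mu>(x := a)) y)) \<phi>)"
      by (rule separable_mono) auto
  qed
  moreover have "(\<lambda>y. (c y, \<mu> y))(x := (i, a)) = (\<lambda>y. ((c(x := i)) y, (\<mu>(x := a)) y))"
    for i a and \<mu> :: "nat \<Rightarrow> 'a"
    by auto
  moreover have "univ (disjoint_union_structure I A) = (SIGMA i:I. univ (A i))"
    for A :: "'i \<Rightarrow> ('r, 'a) struct"
    by (simp add: disjoint_union_structure_def)
  moreover have "(\<exists>p\<in>Sigma I B. Q p) \<longleftrightarrow> (\<exists>i\<in>I. \<exists>a\<in>B i. Q (i, a))"
    for B :: "'i \<Rightarrow> 'a set" and Q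
    by auto
  ultimately show ?case
    by (simp only: sat.simps)
qed

section \<open>Relativization to one component\<close>

primrec relativize :: "'i \<Rightarrow> 'r fm \<Rightarrow> ('i, 'r) sum_symbol fm" where
  "relativize i (FEq x y) = FEq x y"
| "relativize i (FRel r xs) = FRel (Copy i r) xs"
| "relativize i (FNeg \<phi>) = FNeg (relativize i \<phi>)"
| "relativize i (FConj \<phi> \<psi>) = FConj (relativize i \<phi>) (relativize i \<psi>)"
| "relativize i (FEx x \<phi>) = FEx x (FConj (FRel (Mark i) [x]) (relativize i \<phi>))"

lemma is_sentence_relativize:
  assumes "i \<in> I" "is_sentence (\<sigma> i) \<phi>"
  shows "is_sentence (sum_signature I \<sigma>) (relativize i \<phi>)"
proof -
  have "is_formula (sum_signature I \<sigma>) (relativize i \<phi>)" if "is_formula (\<sigma> i) \<phi>"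
    using that assms(1) by (induction \<phi>) (auto simp: sum_signature_def)
  moreover have "free_vars (relativize i \<phi>) = free_vars \<phi>"
    by (induction \<phi>) auto
  ultimately show ?thesis
    using assms(2) by (simp add: is_sentence_def)
qed

text \<open>The guard \<open>Mark i\<close> confines quantified elements to the \<open>i\<close>-th
  copy, so every update keeps the assignment of the form \<open>\<lambda>x. (i, \<mu> x)\<close>; on
  such tuples the copied relations agree with the originals because \<open>Pair i\<close> is
  injective.\<close>

lemma sat_relativize:
  assumes i: "i \<in> I"
  shows "sat (disjoint_union_structure I A) (\<lambda>x. (i, \<mu> x)) (relativize i \<phi>) \<longleftrightarrow> sat (A i) \<mu> \<phi>"
proof (induction \<phi> arbitrary: \<mu>)
  case (FRel r xs)
  have "map (\<lambda>x. (i, \<mu> x)) xs = map (Pair i) t \<longleftrightarrow> map \<mu> xs = t" for t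
    by (induction xs arbitrary: t) (auto simp: Cons_eq_map_conv)
  then have "map (\<lambda>x. (i, \<mu> x)) xs \<in> map (Pair i) ` interp (A i) r \<longleftrightarrow> map \<mu> xs \<in> interp (A i) r"
    unfolding image_iff by metis
  then show ?case
    using i by (simp add: disjoint_union_structure_def)
next
  case (FEx x \<phi>)
  have "(\<lambda>y. (i, \<mu> y))(x := (i, a)) = (\<lambda>y. (i, (\<mu>(x := a)) y))" for a
    by auto
  then have IH: "sat (disjoint_union_structure I A) ((\<lambda>y. (i, \<mu> y))(x := (i, a))) (relativize i \<phi>)
      \<longleftrightarrow> sat (A i) (\<mu>(x := a)) \<phi>" for a
    using FEx.IH by (simp only:)
  have "sat (disjoint_union_structure I A) (\<lambda>y. (i, \<mu> y)) (relativize i (FEx x \<phi>)) \<longleftrightarrow>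
    (\<exists>a\<in>univ (A i).
       sat (disjoint_union_structure I A) ((\<lambda>y. (i, \<mu> y))(x := (i, a))) (relativize i \<phi>))"
    using i by (auto simp: disjoint_union_structure_def)
  then show ?case
    by (simp add: IH)
qed auto

text \<open>A sentence may be tested at any assignment, in particular at one with all tags equal to
  \<open>i\<close>.\<close>

lemma models_relativize:
  assumes "i \<in> I" "is_sentence (\<sigma> i) \<phi>"
  shows "models (disjoint_union_structure I A) (relativize i \<phi>) \<longleftrightarrow> models (A i) \<phi>"
proof -
  fix \<mu>
  have "free_vars \<phi> = {}" "free_vars (relativize i \<phi>) = {}"
    using assms is_sentence_relativize[of i I \<sigma> \<phi>] by (simp_all add: is_sentence_def)
  then show ?thesis
    using models_iff_sat sat_relativize[OF assms(1), of A _ \<phi>] by metis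
qed

section \<open>Recovering the components of a disjoint union\<close>

lemma map_Pair_image_eq_iff: "map (Pair i) ` P = map (Pair i) ` Q \<longleftrightarrow> P = Q"
  by (rule inj_image_eq_iff) (simp add: inj_def)

text \<open>The tags allow recovery on the nose and not merely up to isomorphism: the fibre over
  \<open>i\<close> is the universe of \<open>A i\<close>, and \<open>Copy i r\<close> carries its
  relation \<open>r\<close>.\<close>

lemma inj_on_disjoint_union_structure: "inj_on (disjoint_union_structure I) (Pi\<^sub>E I X)"
proof (rule inj_onI)
  fix A B assume AB: "A \<in> Pi\<^sub>E I X" "B \<in> Pi\<^sub>E I X"
    and eq: "disjoint_union_structure I A = disjoint_union_structure I B"
  show "A = B"
  proof (rule PiE_ext[OF AB])
    fix i assume i: "i \<in> I"
    have "(SIGMA i:I. univ (A i)) = (SIGMA i:I. univ (B i))"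
      using arg_cong[OF eq, of univ] by (simp add: disjoint_union_structure_def)
    then have "univ (A i) = univ (B i)"
      using i by auto
    moreover have "interp (A i) r = interp (B i) r" for r
      using arg_cong[OF eq, of "\<lambda>M. interp M (Copy i r)"] i
      by (simp add: disjoint_union_structure_def map_Pair_image_eq_iff)
    ultimately show "A i = B i"
      by (intro struct.expand) auto
  qed
qed

section \<open>The logical product\<close>

lemma FO_sets_disjoint_union_rect_unions:
  fixes X :: "'i \<Rightarrow> ('r, 'a) struct set"
  assumes fin: "finite I"
    and U: "U \<in> FO_sets (sum_signature I \<sigma>) (logical_product_carrier I X)"
  shows "{A \<in> Pi\<^sub>E I X. disjoint_union_structure I A \<in> U}
    \<in> rect_unions I (\<lambda>i. FO_sets (\<sigma> i) (X i))"
proof -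
  obtain \<phi> where \<phi>: "is_formula (sum_signature I \<sigma>) \<phi>" "free_vars \<phi> = {}"
    and U_eq: "U = {M \<in> logical_product_carrier I X. models M \<phi>}"
    using U unfolding FO_sets_def is_sentence_def by blast
  \<comment> \<open>Both are arbitrary: since \<open>\<phi>\<close> has no free variables, nothing
    forces the values of \<open>c\<close> into \<open>I\<close>, and \<open>I\<close> may be
    empty.\<close>
  fix c :: "nat \<Rightarrow> 'i" and \<mu> :: "nat \<Rightarrow> 'a"
  have "separable I \<sigma> (\<lambda>i. {x \<in> free_vars \<phi>. c x = i})
      (\<lambda>A (\<mu> :: nat \<Rightarrow> 'a). sat (disjoint_union_structure I A) (\<lambda>x. (c x, \<mu> x)) \<phi>)"
    using separable_sat_disjoint_union[OF fin \<phi>(1)] \<phi>(2) by simp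
  then obtain K where K: "finite K"
    "\<forall>\<psi>\<in>K. \<forall>i\<in>I. is_formula (\<sigma> i) (\<psi> i) \<and> free_vars (\<psi> i) \<subseteq> {x \<in> free_vars \<phi>. c x = i}"
    "(\<lambda>A (\<mu> :: nat \<Rightarrow> 'a). sat (disjoint_union_structure I A) (\<lambda>x. (c x, \<mu> x)) \<phi>)
      = (\<lambda>A \<mu>. \<exists>\<psi>\<in>K. \<forall>i\<in>I. sat (A i) \<mu> (\<psi> i))"
    by (rule separableE)
  have sent: "is_sentence (\<sigma> i) (\<psi> i)" if "\<psi> \<in> K" "i \<in> I" for \<psi> i
    using K(2) that \<phi>(2) by (auto simp: is_sentence_def)
  have models_iff: "models (disjoint_union_structure I A) \<phi> \<longleftrightarrow>
      (\<exists>\<psi>\<in>K. \<forall>i\<in>I. models (A i) (\<psi> i))"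
    for A :: "'i \<Rightarrow> ('r, 'a) struct"
  proof -
    have "models (disjoint_union_structure I A) \<phi> \<longleftrightarrow>
        sat (disjoint_union_structure I A) (\<lambda>x. (c x, \<mu> x)) \<phi>"
      by (rule models_iff_sat[OF \<phi>(2)])
    also have "\<dots> \<longleftrightarrow> (\<exists>\<psi>\<in>K. \<forall>i\<in>I. sat (A i) \<mu> (\<psi> i))"
      using fun_cong[OF fun_cong[OF K(3), of A], of \<mu>] .
    also have "\<dots> \<longleftrightarrow> (\<exists>\<psi>\<in>K. \<forall>i\<in>I. models (A i) (\<psi> i))"
    proof (intro bex_cong ball_cong refl)
      fix \<psi> i assume "\<psi> \<in> K" "i \<in> I"
      then show "sat (A i) \<mu> (\<psi> i) \<longleftrightarrow> models (A i) (\<psi> i)"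
        using models_iff_sat[of "\<psi> i" "A i" \<mu>] sent[of \<psi> i] by (simp add: is_sentence_def)
    qed
    finally show ?thesis .
  qed
  let ?rect = "\<lambda>\<psi>. \<Pi>\<^sub>E i\<in>I. {B \<in> X i. models B (\<psi> i)}"
  have "{A \<in> Pi\<^sub>E I X. disjoint_union_structure I A \<in> U} = \<Union>(?rect ` K)"
  proof -
    have inU: "disjoint_union_structure I A \<in> U \<longleftrightarrow> (\<exists>\<psi>\<in>K. \<forall>i\<in>I. models (A i) (\<psi> i))"
      if "A \<in> Pi\<^sub>E I X" for A
      using that by (simp add: U_eq logical_product_carrier_def models_iff)
    have rect: "A \<in> ?rect \<psi> \<longleftrightarrow> A \<in> Pi\<^sub>E I X \<and> (\<forall>i\<in>I. models (A i) (\<psi> i))" for A \<psi>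
      by (auto simp: PiE_iff)
    have "A \<in> Pi\<^sub>E I X \<and> disjoint_union_structure I A \<in> U \<longleftrightarrow> (\<exists>\<psi>\<in>K. A \<in> ?rect \<psi>)" for A
      by (cases "A \<in> Pi\<^sub>E I X") (simp_all only: inU rect simp_thms bex_simps ball_triv)
    then show ?thesis
      by (simp only: set_eq_iff UN_iff mem_Collect_eq simp_thms)
  qed
  moreover have "?rect ` K \<subseteq> rects I (\<lambda>i. FO_sets (\<sigma> i) (X i))"
    using sent by (auto intro!: PiE_in_rects simp: FO_sets_def)
  ultimately show ?thesis
    using K(1) unfolding rect_unions_def by blast
qed

text \<open>The condition on one side is expressed by relativizing its defining sentence; a
  rectangle is then a finite intersection of such definable sets.\<close>

lemma rect_unions_image_FO_sets:
  fixes X :: "'i \<Rightarrow> ('r, 'a) struct set"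
  assumes fin: "finite I" and W: "W \<in> rect_unions I (\<lambda>i. FO_sets (\<sigma> i) (X i))"
  shows "disjoint_union_structure I ` W
    \<in> FO_sets (sum_signature I \<sigma>) (logical_product_carrier I X)"
proof -
  let ?f = "disjoint_union_structure I" and ?Y = "logical_product_carrier I X"
  let ?LY = "FO_sets (sum_signature I \<sigma>) ?Y"
  note lat = bounded_sublattice_FO_sets[of ?Y "sum_signature I \<sigma>"]
  have rect: "?f ` R \<in> ?LY" if R: "R \<in> rects I (\<lambda>i. FO_sets (\<sigma> i) (X i))" for R
  proof -
    obtain U where U: "R = Pi\<^sub>E I U" "\<And>i. i \<in> I \<Longrightarrow> U i \<in> FO_sets (\<sigma> i) (X i)"
      using R by (rule rectsE) (rule that)
    have "\<forall>i\<in>I. \<exists>\<psi>. is_sentence (\<sigma> i) \<psi> \<and> U i = {B \<in> X i. models B \<psi>}"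
      using U(2) unfolding FO_sets_def by blast
    then obtain \<psi> where \<psi>: "\<forall>i\<in>I. is_sentence (\<sigma> i) (\<psi> i) \<and> U i = {B \<in> X i. models B (\<psi> i)}"
      using bchoice[of I "\<lambda>i \<psi>. is_sentence (\<sigma> i) \<psi> \<and> U i = {B \<in> X i. models B \<psi>}"] by blast
    let ?D = "\<lambda>i. {M \<in> ?Y. models M (relativize i (\<psi> i))}"
    have mem: "?f A \<in> ?D i \<longleftrightarrow> A i \<in> U i" if "A \<in> Pi\<^sub>E I X" "i \<in> I" for A i
    proof -
      have "models (?f A) (relativize i (\<psi> i)) \<longleftrightarrow> models (A i) (\<psi> i)"
        using \<psi> \<open>i \<in> I\<close> by (intro models_relativize[where \<sigma> = \<sigma>]) auto
      moreover have "?f A \<in> ?Y" "A i \<in> X i"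
        using that by (auto simp: logical_product_carrier_def)
      ultimately show ?thesis
        using \<psi> \<open>i \<in> I\<close> by simp
    qed
    have RX: "A \<in> R \<longleftrightarrow> A \<in> Pi\<^sub>E I X \<and> (\<forall>i\<in>I. A i \<in> U i)" for A
      using \<psi> by (auto simp: U(1) PiE_iff)
    \<comment> \<open>Inserting \<open>?Y\<close> keeps the intersection inside the carrier when
      \<open>I\<close> is empty.\<close>
    have "?f ` R = \<Inter>(insert ?Y (?D ` I))"
    proof (intro equalityI subsetI)
      fix M assume "M \<in> ?f ` R"
      then obtain A where "M = ?f A" "A \<in> Pi\<^sub>E I X" "\<forall>i\<in>I. A i \<in> U i"
        using RX by blast
      then show "M \<in> \<Inter>(insert ?Y (?D ` I))"
        using mem by (auto simp: logical_product_carrier_def)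
    next
      fix M assume M: "M \<in> \<Inter>(insert ?Y (?D ` I))"
      then obtain A where A: "M = ?f A" "A \<in> Pi\<^sub>E I X"
        by (auto simp: logical_product_carrier_def)
      have "A i \<in> U i" if "i \<in> I" for i
        using M mem[OF A(2) that] that unfolding A(1) by blast
      then show "M \<in> ?f ` R"
        using A RX by blast
    qed
    also have "\<dots> \<in> ?LY"
    proof (rule bounded_sublattice_Inter[OF lat])
      have "?D i \<in> ?LY" if "i \<in> I" for i
        using \<psi> that is_sentence_relativize[of i I \<sigma> "\<psi> i"] unfolding FO_sets_def by blast
      then show "insert ?Y (?D ` I) \<subseteq> ?LY"
        using lat by (auto simp: bounded_sublattice_def)
    qed (use fin in auto)
    finally show ?thesis .
  qed
  obtain F where F: "finite F" "F \<subseteq> rects I (\<lambda>i. FO_sets (\<sigma> i) (X i))" "W = \<Union>F"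
    using W unfolding rect_unions_def by blast
  have "?f ` W = \<Union>((`) ?f ` F)"
    unfolding F(3) by blast
  also have "\<dots> \<in> ?LY"
    using F(1,2) rect by (intro bounded_sublattice_Union[OF lat]) auto
  finally show ?thesis .
qed

text \<open>The generating sets already form a topology, the final one along the disjoint union map.
  Instead of checking closure, the proof shows this map continuous into the generated topology, so
  that every generated open set has an open preimage.\<close>

lemma openin_logical_product_topology_iff:
  assumes ts: "\<And>i. i \<in> I \<Longrightarrow> topspace (\<tau> i) = X i"
  shows "openin (logical_product_topology I X \<tau>) U \<longleftrightarrow> U \<subseteq> logical_product_carrier I X \<and>
    openin (product_topology \<tau> I) {A \<in> Pi\<^sub>E I X. disjoint_union_structure I A \<in> U}"
    (is "?op U \<longleftrightarrow> ?P U")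
proof
  have E: "topspace (product_topology \<tau> I) = Pi\<^sub>E I X"
    using ts by (auto simp: PiE_iff)
  have Y: "logical_product_carrier I X \<in> {U. ?P U}"
  proof -
    have "{A \<in> Pi\<^sub>E I X. disjoint_union_structure I A \<in> logical_product_carrier I X} = Pi\<^sub>E I X"
      by (auto simp only: logical_product_carrier_def)
    then show ?thesis
      using openin_topspace[of "product_topology \<tau> I"] unfolding E by simp
  qed
  have vimage: "{A \<in> Pi\<^sub>E I X. disjoint_union_structure I A \<in> V}
      = disjoint_union_structure I -` V \<inter> Pi\<^sub>E I X" for V
    by auto
  have cont: "continuous_map (product_topology \<tau> I) (logical_product_topology I X \<tau>)
      (disjoint_union_structure I)"
    unfolding logical_product_topology_def
  proof (rule continuous_on_generated_topo)
    show "disjoint_union_structure I ` topspace (product_topology \<tau> I) \<subseteq> \<Union>{U. ?P U}"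
      using Y unfolding E logical_product_carrier_def by blast
  qed (simp add: E vimage del: topspace_product_topology)
  assume op: "?op U"
  have "U \<subseteq> logical_product_carrier I X"
    using openin_subset[OF op] unfolding logical_product_topology_def by auto
  moreover have "openin (product_topology \<tau> I) {A \<in> Pi\<^sub>E I X. disjoint_union_structure I A \<in> U}"
    using openin_continuous_map_preimage[OF cont op] by (simp only: E)
  ultimately show "?P U" ..
next
  assume "?P U"
  then show "?op U"
    unfolding logical_product_topology_def by (intro topology_generated_by_Basis CollectI)
qed

text \<open>Products are unique only up to isomorphism, so the universal property is stated for the
  concrete space \<open>product_topology S I\<close>. A homeomorphism preserves compact open sets
  and is thus an isomorphism in the category.\<close>

theorem proposition5p14:
  fixes I :: "'i set"
    and \<sigma> :: "'i \<Rightarrow> 'r signature"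
    and X :: "'i \<Rightarrow> ('r, 'a) struct set"
    and \<tau> :: "'i \<Rightarrow> ('r, 'a) struct topology"
  assumes "finite I"
    and "\<And>i. i \<in> I \<Longrightarrow> finite (dom (\<sigma> i))"
    and "\<And>i A. i \<in> I \<Longrightarrow> A \<in> X i \<Longrightarrow> is_structure (\<sigma> i) A"
    and "\<And>i. i \<in> I \<Longrightarrow>
           logically_presented_prespectral (X i) (\<tau> i) (FO_sets (\<sigma> i) (X i))"
  defines "S \<equiv> \<lambda>i. presented_topology (\<tau> i) (FO_sets (\<sigma> i) (X i))"
    and "Y \<equiv> logical_product_carrier I X"
    and "\<tau>Y \<equiv> logical_product_topology I X \<tau>"
    and "LY \<equiv> FO_sets (sum_signature I \<sigma>) (logical_product_carrier I X)"
  shows "logically_presented_prespectral Y \<tau>Y LY \<and>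
         PreSpec_product TYPE('z) I S (product_topology S I) (\<lambda>i x. x i) \<and>
         presented_topology \<tau>Y LY homeomorphic_space product_topology S I"
proof -
  note fin = \<open>finite I\<close>
  define f :: "('i \<Rightarrow> ('r, 'a) struct) \<Rightarrow> _" where "f = disjoint_union_structure I"
  define FO where "FO = (\<lambda>i. FO_sets (\<sigma> i) (X i))"
  \<comment> \<open>\<open>M i\<close> will be the lattice of compact open sets of
    \<open>S i\<close>, and \<open>R\<close> that of the product of the \<open>S i\<close>.\<close>
  define M where "M = (\<lambda>i. {U. openin (\<tau> i) U} \<inter> FO i)"
  define R where "R = rect_unions I M"
  have ts: "topspace (\<tau> i) = X i" if "i \<in> I" for i
    using assms(4)[OF that] by (simp add: logically_presented_prespectral_def)
  have FO: "bounded_sublattice (topspace (\<tau> i)) (FO i)" if "i \<in> I" for i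
    unfolding FO_def ts[OF that] by (rule bounded_sublattice_FO_sets)
  have M: "bounded_sublattice (X i) (M i)" if "i \<in> I" for i
    using bounded_sublattice_open_sets[OF FO[OF that]] by (simp add: M_def ts[OF that])
  have S: "S i = topology_generated_by (M i)" for i
    by (simp add: S_def M_def FO_def presented_topology_def)
  have cpt: "compactin (topology_generated_by (M i)) U" if "i \<in> I" "U \<in> M i" for i U
    using assms(4)[OF that(1)] that(2) S[of i]
    by (simp add: logically_presented_prespectral_def M_def FO_def S_def)
  have pre: "prespectral (S i)" and co: "compact_opens (S i) = M i" if "i \<in> I" for i
    unfolding S using prespectral_generated_by_lattice[OF M[OF that] cpt[OF that]]
      compact_opens_generated_by_lattice[OF M[OF that] cpt[OF that]] by simp_all
  \<comment> \<open>The two families of lattices are known to agree only on \<open>I\<close>, hence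
    monotonicity in both directions instead of rewriting.\<close>
  have R_eq: "rect_unions I (\<lambda>i. compact_opens (S i)) = R"
    using rect_unions_mono[of I "\<lambda>i. compact_opens (S i)" M]
      rect_unions_mono[of I M "\<lambda>i. compact_opens (S i)"] co by (simp add: R_def subset_antisym)
  have prodS: "product_topology S I = topology_generated_by R"
    using product_topology_generated_by_rect_unions[OF fin pre] by (simp only: R_eq)
  have R_cpt: "compactin (product_topology S I) W" if "W \<in> R" for W
  proof -
    have "compact_opens (product_topology S I) = R"
      unfolding R_eq[symmetric] using fin pre by (rule compact_opens_product_topology)
    then show ?thesis
      using that by (auto simp: compact_opens_def)
  qed
  have R_lat: "bounded_sublattice (Pi\<^sub>E I X) R"
    unfolding R_def using M by (rule bounded_sublattice_rect_unions)
  have inj: "inj_on f (Pi\<^sub>E I X)"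
    unfolding f_def by (rule inj_on_disjoint_union_structure)
  have Y: "Y = f ` Pi\<^sub>E I X"
    by (simp add: Y_def f_def logical_product_carrier_def)
  have openY: "openin \<tau>Y U \<longleftrightarrow> U \<subseteq> Y \<and> openin (product_topology \<tau> I) {A \<in> Pi\<^sub>E I X. f A \<in> U}"
    for U
    unfolding \<tau>Y_def Y_def f_def using ts by (rule openin_logical_product_topology_iff)
  \<comment> \<open>The heart of the argument. Openness in \<open>\<tau>Y\<close> refers to the
    product of the \<open>\<tau> i\<close>, which may be finer than the product of the
    \<open>S i\<close>; \<open>open_rect_unions\<close> bridges the gap for definable sets.\<close>
  have N: "{U. openin \<tau>Y U} \<inter> LY = (`) f ` R"
  proof (intro equalityI subsetI)
    fix U assume U: "U \<in> {U. openin \<tau>Y U} \<inter> LY"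
    define W where "W = {A \<in> Pi\<^sub>E I X. f A \<in> U}"
    have "W \<in> rect_unions I FO"
      using U FO_sets_disjoint_union_rect_unions[OF fin, where U = U and \<sigma> = \<sigma> and X = X]
      by (simp add: W_def FO_def f_def LY_def)
    moreover have "openin (product_topology \<tau> I) W"
      using U openY unfolding W_def by blast
    ultimately have "W \<in> R"
      unfolding R_def M_def using open_rect_unions[OF fin, where T = \<tau> and L = FO and W = W] FO by blast
    moreover have "U = f ` W"
      using U openY unfolding W_def Y by blast
    ultimately show "U \<in> (`) f ` R"
      by blast
  next
    fix U assume "U \<in> (`) f ` R"
    then obtain W where W: "W \<in> R" "U = f ` W"
      by blast
    have WE: "W \<subseteq> Pi\<^sub>E I X"
      using W(1) R_lat by (auto simp: bounded_sublattice_def)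
    have "W \<in> rect_unions I FO"
      using W(1) rect_unions_mono[of I M FO] unfolding R_def M_def by blast
    then have "U \<in> LY"
      using rect_unions_image_FO_sets[OF fin, where W = W and \<sigma> = \<sigma> and X = X] by (simp add: W(2) f_def LY_def FO_def)
    have "openin (product_topology \<tau> I) Q" if Q: "Q \<in> rects I M" for Q
    proof -
      obtain V where V: "Q = Pi\<^sub>E I V" "\<And>i. i \<in> I \<Longrightarrow> V i \<in> M i"
        using Q by (rule rectsE) (rule that)
      then show ?thesis
        using fin by (simp add: openin_PiE M_def)
    qed
    then have "openin (product_topology \<tau> I) W"
      using W(1) unfolding R_def rect_unions_def by auto
    moreover have "{A \<in> Pi\<^sub>E I X. f A \<in> U} = W"
      using inj_on_image_mem_iff[OF inj _ WE] WE unfolding W(2) by blast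
    moreover have "U \<subseteq> Y"
      using WE by (auto simp: W(2) Y)
    ultimately have "openin \<tau>Y U"
      by (simp add: openY)
    then show "U \<in> {U. openin \<tau>Y U} \<inter> LY"
      using \<open>U \<in> LY\<close> by simp
  qed
  have presY: "presented_topology \<tau>Y LY = topology_generated_by ((`) f ` R)"
    by (simp add: presented_topology_def N)
  have homeo: "homeomorphic_map (product_topology S I) (presented_topology \<tau>Y LY) f"
    unfolding presY prodS using inj R_lat
    by (intro homeomorphic_map_generated_image) (auto simp: bounded_sublattice_def)
  have "Pi\<^sub>E I X \<in> R"
    using R_lat by (simp add: bounded_sublattice_def)
  then have "openin \<tau>Y Y"
    using N Y by blast
  moreover have "topspace \<tau>Y \<subseteq> Y"
    using openY openin_topspace by blast
  ultimately have "topspace \<tau>Y = Y"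
    by (simp add: openin_subset subset_antisym)
  moreover have "bounded_sublattice Y LY"
    unfolding Y_def LY_def by (rule bounded_sublattice_FO_sets)
  \<comment> \<open>Every such set is the image of a member of \<open>R\<close> under
    \<open>f\<close>, and continuous images of compact sets are compact.\<close>
  moreover have "compactin (presented_topology \<tau>Y LY) U" if "U \<in> {U. openin \<tau>Y U} \<inter> LY" for U
    using that R_cpt image_compactin homeomorphic_imp_continuous_map[OF homeo] unfolding N by blast
  ultimately have "logically_presented_prespectral Y \<tau>Y LY"
    by (simp add: logically_presented_prespectral_def)
  moreover have "PreSpec_product TYPE('z) I S (product_topology S I) (\<lambda>i x. x i)"
    using fin pre by (rule PreSpec_product_product_topology)
  moreover have "presented_topology \<tau>Y LY homeomorphic_space product_topology S I"
    using homeomorphic_map_imp_homeomorphic_space[OF homeo] homeomorphic_space_sym by blast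
  ultimately show ?thesis
    by blast
qed

end
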